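(* Let $K$ be a field of characteristic zero and $S=K[x_1,x_2,x_3]$. Let $d_1,d_2,d_3$ be positive integers and let $f_1,f_2,f_3\in S$ be a regular sequence of homogeneous polynomials of degrees $d_1,d_2,d_3$ respectively. Put $I=(f_1,f_2,f_3)$ and suppose that $S/I$ has the strong Lefschetz property. Then $J=\operatorname{Gin}(I)$ is uniquely determined, i.e. it depends only on $(d_1,d_2,d_3)$: if $f_1',f_2',f_3'$ is another regular sequence of homogeneous polynomials of degrees $d_1,d_2,d_3$ with $I'=(f_1',f_2',f_3')$ and $S/I'$ having the strong Lefschetz property, then $\operatorname{Gin}(I')=\operatorname{Gin}(I)$. Moreover, $J$ is an almost reverse lexicographic ideal.
   Context: The monomial order is the reverse lexicographic order with $x_1>x_2>x_3$: for monomials of the same degree, $x^a>x^b$ iff the last nonzero entry of $a-b$ is negative. $\operatorname{Gin}(I)$ denotes the generic initial ideal of $I$ with respect to this order, i.e. the initial ideal $\operatorname{in}(g(I))$ for $g$ in a nonempty Zariski open subset of $GL_3(K)$ acting by linear change of variables. For $A=S/I$ artinian graded, $A$ has the strong Lefschetz property if there is a linear form $\ell\in S$ such that for every integer $b\ge 1$ and every $t\ge 0$ the multiplication map $A_t\xrightarrow{\cdot \ell^b}A_{t+b}$ is injective or surjective. A monomial ideal $J$ is almost reverse lexicographic if whenever $u$ is a minimal monomial generator of $J$ and $v$ is a monomial with $\deg v=\deg u$ and $v>u$ in the reverse lexicographic order, then $v\in J$. *)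

theory Defs
  imports "HOL-Library.Poly_Mapping" "HOL-Library.Product_Plus"
begin

text \<open>A monomial x1^a1 x2^a2 x3^a3 is represented by its exponent vector (a1,a2,a3);
  monomial multiplication is addition of exponents. A polynomial is a finitely supported
  map from exponent vectors to coefficients (Poly_Mapping), with convolution product.\<close>

type_synonym mon3 = "nat \<times> nat \<times> nat"
type_synonym 'a poly3 = "mon3 \<Rightarrow>\<^sub>0 'a"

definition mdeg :: "mon3 \<Rightarrow> nat" where
  "mdeg a = fst a + fst (snd a) + snd (snd a)"

definition monom :: "mon3 \<Rightarrow> 'a::zero_neq_one poly3" where
  "monom a = Poly_Mapping.single a 1"

definition var3 :: "nat \<Rightarrow> 'a::zero_neq_one poly3" where
  "var3 i = (if i = 0 then monom (1,0,0) else if i = 1 then monom (0,1,0) else monom (0,0,1))"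

definition homogeneous :: "nat \<Rightarrow> 'a::zero poly3 \<Rightarrow> bool" where
  "homogeneous d f \<longleftrightarrow> (\<forall>a \<in> Poly_Mapping.keys f. mdeg a = d)"

definition ideal_gen :: "'a::comm_ring_1 poly3 set \<Rightarrow> 'a poly3 set" where
  "ideal_gen G = {(\<Sum>i<(n::nat). c i * g i) | n c g. \<forall>i<n. g i \<in> G}"

definition regular_seq3 :: "'a::comm_ring_1 poly3 \<Rightarrow> 'a poly3 \<Rightarrow> 'a poly3 \<Rightarrow> bool" where
  "regular_seq3 f1 f2 f3 \<longleftrightarrow>
     (\<forall>g. g * f1 \<in> ideal_gen {} \<longrightarrow> g \<in> ideal_gen {}) \<and>
     (\<forall>g. g * f2 \<in> ideal_gen {f1} \<longrightarrow> g \<in> ideal_gen {f1}) \<and>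
     (\<forall>g. g * f3 \<in> ideal_gen {f1, f2} \<longrightarrow> g \<in> ideal_gen {f1, f2}) \<and>
     1 \<notin> ideal_gen {f1, f2, f3}"

text \<open>For A = S/I, A_t = S_t/I_t where S_t is the space of homogeneous polynomials of degree t.
  Multiplication by l^b from A_t to A_(t+b) is injective iff for g in S_t, l^b g in I implies
  g in I; it is surjective iff every h in S_(t+b) is congruent mod I to l^b g for some g in S_t.\<close>
definition mult_inj :: "'a::comm_ring_1 poly3 set \<Rightarrow> 'a poly3 \<Rightarrow> nat \<Rightarrow> nat \<Rightarrow> bool" where
  "mult_inj I l b t \<longleftrightarrow> (\<forall>g. homogeneous t g \<longrightarrow> l ^ b * g \<in> I \<longrightarrow> g \<in> I)"

definition mult_surj :: "'a::comm_ring_1 poly3 set \<Rightarrow> 'a poly3 \<Rightarrow> nat \<Rightarrow> nat \<Rightarrow> bool" where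
  "mult_surj I l b t \<longleftrightarrow>
     (\<forall>h. homogeneous (t + b) h \<longrightarrow> (\<exists>g. homogeneous t g \<and> h - l ^ b * g \<in> I))"

definition strong_lefschetz :: "'a::comm_ring_1 poly3 set \<Rightarrow> bool" where
  "strong_lefschetz I \<longleftrightarrow>
     (\<exists>l. homogeneous 1 l \<and>
        (\<forall>b t. b \<ge> 1 \<longrightarrow> mult_inj I l b t \<or> mult_surj I l b t))"

definition revlex_gt :: "mon3 \<Rightarrow> mon3 \<Rightarrow> bool" where
  "revlex_gt a b \<longleftrightarrow>
     mdeg a > mdeg b \<or>
     (mdeg a = mdeg b \<and>
       (if snd (snd a) \<noteq> snd (snd b) then snd (snd a) < snd (snd b)
        else if fst (snd a) \<noteq> fst (snd b) then fst (snd a) < fst (snd b)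
        else fst a < fst b))"

definition lead_mon :: "'a::zero poly3 \<Rightarrow> mon3" where
  "lead_mon f = (THE a. a \<in> Poly_Mapping.keys f \<and>
                        (\<forall>b \<in> Poly_Mapping.keys f. b \<noteq> a \<longrightarrow> revlex_gt a b))"

definition initial_ideal :: "'a::comm_ring_1 poly3 set \<Rightarrow> 'a poly3 set" where
  "initial_ideal I = ideal_gen {monom (lead_mon f) | f. f \<in> I \<and> f \<noteq> 0}"

text \<open>3x3 matrices are functions nat => nat => 'a of which only entries (i,j) with i,j < 3 matter.\<close>
definition det3 :: "(nat \<Rightarrow> nat \<Rightarrow> 'a::comm_ring_1) \<Rightarrow> 'a" where
  "det3 M = M 0 0 * M 1 1 * M 2 2 + M 0 1 * M 1 2 * M 2 0 + M 0 2 * M 1 0 * M 2 1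
          - M 0 2 * M 1 1 * M 2 0 - M 0 0 * M 1 2 * M 2 1 - M 0 1 * M 1 0 * M 2 2"

definition GL3 :: "(nat \<Rightarrow> nat \<Rightarrow> 'a::field) set" where
  "GL3 = {M. det3 M \<noteq> 0}"

definition lin_form :: "(nat \<Rightarrow> nat \<Rightarrow> 'a::comm_ring_1) \<Rightarrow> nat \<Rightarrow> 'a poly3" where
  "lin_form M j = (\<Sum>i<3. Poly_Mapping.single (0,0,0) (M i j) * var3 i)"

definition subst3 :: "(nat \<Rightarrow> nat \<Rightarrow> 'a::comm_ring_1) \<Rightarrow> 'a poly3 \<Rightarrow> 'a poly3" where
  "subst3 M f = (\<Sum>a \<in> Poly_Mapping.keys f.
      Poly_Mapping.single (0,0,0) (Poly_Mapping.lookup f a) *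
      lin_form M 0 ^ fst a * lin_form M 1 ^ fst (snd a) * lin_form M 2 ^ snd (snd a))"

definition act_ideal :: "(nat \<Rightarrow> nat \<Rightarrow> 'a::comm_ring_1) \<Rightarrow> 'a poly3 set \<Rightarrow> 'a poly3 set" where
  "act_ideal M I = subst3 M ` I"

text \<open>Polynomial functions on the 9 matrix entries: P is a polynomial in variables y_(i,j),
  i,j < 3, and eval_mat P M is its value at the matrix M.\<close>
definition mat_poly :: "(((nat \<times> nat) \<Rightarrow>\<^sub>0 nat) \<Rightarrow>\<^sub>0 'a::zero) \<Rightarrow> bool" where
  "mat_poly P \<longleftrightarrow> (\<forall>m \<in> Poly_Mapping.keys P. Poly_Mapping.keys m \<subseteq> {0..<3} \<times> {0..<3})"

definition eval_mat :: "(((nat \<times> nat) \<Rightarrow>\<^sub>0 nat) \<Rightarrow>\<^sub>0 'a::comm_ring_1) \<Rightarrow> (nat \<Rightarrow> nat \<Rightarrow> 'a) \<Rightarrow> 'a" where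
  "eval_mat P M = (\<Sum>m \<in> Poly_Mapping.keys P. Poly_Mapping.lookup P m *
      (\<Prod>ij \<in> Poly_Mapping.keys m. M (fst ij) (snd ij) ^ Poly_Mapping.lookup m ij))"

definition zariski_open_GL3 :: "(nat \<Rightarrow> nat \<Rightarrow> 'a::field) set \<Rightarrow> bool" where
  "zariski_open_GL3 U \<longleftrightarrow>
     (\<exists>T. (\<forall>P \<in> T. mat_poly P) \<and> U = {M \<in> GL3. \<exists>P \<in> T. eval_mat P M \<noteq> 0})"

definition is_gin :: "'a::field poly3 set \<Rightarrow> 'a poly3 set \<Rightarrow> bool" where
  "is_gin I J \<longleftrightarrow>
     (\<exists>U. zariski_open_GL3 U \<and> U \<noteq> {} \<and> (\<forall>M \<in> U. initial_ideal (act_ideal M I) = J))"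

definition mon_dvd :: "mon3 \<Rightarrow> mon3 \<Rightarrow> bool" where
  "mon_dvd a b \<longleftrightarrow> fst a \<le> fst b \<and> fst (snd a) \<le> fst (snd b) \<and> snd (snd a) \<le> snd (snd b)"

definition min_mon_gen :: "'a::comm_ring_1 poly3 set \<Rightarrow> mon3 \<Rightarrow> bool" where
  "min_mon_gen J u \<longleftrightarrow> monom u \<in> J \<and> (\<forall>v. mon_dvd v u \<and> v \<noteq> u \<longrightarrow> monom v \<notin> J)"

definition almost_revlex :: "'a::comm_ring_1 poly3 set \<Rightarrow> bool" where
  "almost_revlex J \<longleftrightarrow>
     (\<forall>u v. min_mon_gen J u \<and> mdeg v = mdeg u \<and> revlex_gt v u \<longrightarrow> monom v \<in> J)"

end

theory Submission
  imports Defs "HOL-Computational_Algebra.Polynomial"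
begin

text \<open>Let \<open>h\<close> be the Hilbert function of \<open>A = S/I\<close>; for a complete intersection it depends only on the
  degrees. The strong Lefschetz property prescribes the rank of every map \<open>l^k : A_t \<rightarrow> A_(t+k)\<close> as
  \<open>min (h t) (h (t+k))\<close>. Put \<open>l\<close> as the last coordinate. Since the order is reverse lexicographic,
  the standard monomials with last exponent \<open>k\<close> and degree \<open>t + k\<close> form a basis of
  \<open>l^k A_t / l^(k+1) A_(t-1)\<close>, a quotient of the space of binary forms of degree \<open>t\<close>, so their number is
  determined by \<open>h\<close>. In characteristic 0, for a general second coordinate \<open>y\<close>, an \<open>r\<close>-dimensional
  space of binary forms contains no nonzero form divisible by \<open>y^r\<close>; hence the standard monomials
  are those with small exponent of \<open>x1\<close>, and the whole set of standard monomials is a function of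
  \<open>h\<close>. Independence of this set modulo the transformed ideal is an open condition on the
  coordinates, and by counting it already determines the initial ideal. The almost reverse
  lexicographic property is then a consequence of the unimodality of \<open>h\<close>.\<close>

subsection \<open>Linear algebra\<close>

text \<open>The quotient A is never formed: \<open>proj I\<close> is a linear endomorphism of the
  polynomial ring with kernel \<open>I\<close>, and dimensions in A are dimensions of images under
  it. Independence is proved directly for one coordinate system only, built from a Lefschetz
  element. In the other coordinate systems of the open set nothing is known about the last
  coordinate, but none is needed: multiplication by powers of any linear form has at most the rank
  that a Lefschetz element attains, and this bound equals the number of standard monomials in the
  corresponding slice. So independence forces spanning in all these coordinates alike. The open set
  is described with the adjugate, since the entries of the inverse are not polynomials. The two
  differ by a nonzero scalar, which rescales every homogeneous component and preserves independence.
  The degrees enter only through the Hilbert function, which vanishes from d1 + d2 + d3 on. Hence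
  there are finitely many standard monomials, and only finitely many values have to be avoided when
  the second coordinate is chosen.\<close>

context vector_space
begin

text \<open>\<open>dim\<close> is the cardinality of a basis, hence 0 when the basis is infinite.
  The polynomial ring is infinite-dimensional, so finiteness is carried along as containment in the
  span of a finite \<open>F\<close>.\<close>

lemma indep_extend_finite_basis:
  assumes "B \<subseteq> V" "independent B" "V \<subseteq> span F" "finite F"
  obtains C where "B \<subseteq> C" "C \<subseteq> V" "independent C" "V \<subseteq> span C" "finite C" "card C = dim V"
proof -
  obtain C where C: "B \<subseteq> C" "C \<subseteq> V" "independent C" "V \<subseteq> span C"
    using maximal_independent_subset_extend[OF assms(1,2)] by blast
  have "finite C" using independent_span_bound[OF assms(4) C(3)] C(2) assms(3) by blast
  then show ?thesis using C that basis_card_eq_dim by metis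
qed

lemma card_independent_le_dim:
  assumes "B \<subseteq> V" "independent B" "V \<subseteq> span F" "finite F"
  shows "card B \<le> dim V"
  using indep_extend_finite_basis[OF assms] card_mono by metis

lemma dim_mono_finite:
  assumes "U \<subseteq> V" "V \<subseteq> span F" "finite F"
  shows "dim U \<le> dim V"
proof -
  obtain B where B: "B \<subseteq> U" "independent B" "U \<subseteq> span B" "card B = dim U" by (rule basis_exists)
  then show ?thesis using card_independent_le_dim[of B V F] assms by auto
qed

lemma independent_card_ge_dim_spans:
  assumes "B \<subseteq> V" "independent B" "V \<subseteq> span F" "finite F" "dim V \<le> card B"
  shows "V \<subseteq> span B"
proof -
  obtain C where C: "B \<subseteq> C" "C \<subseteq> V" "V \<subseteq> span C" "finite C" "card C = dim V"
    by (rule indep_extend_finite_basis[OF assms(1-4)])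
  then have "B = C" using assms(5) by (metis card_seteq)
  then show ?thesis using C by simp
qed

text \<open>Independence of a set ignores repetitions, and distinct monomials may have equal images
  modulo an ideal. A repetition is itself a relation, with coefficients 1 and -1, so injectivity
  follows too, and with it the count of the image.\<close>

lemma independent_family:
  assumes "finite B" "\<And>c. (\<Sum>b\<in>B. scale (c b) (v b)) = 0 \<Longrightarrow> \<forall>b\<in>B. c b = 0"
  shows "inj_on v B" "independent (v ` B)"
proof -
  show inj: "inj_on v B"
  proof (rule inj_onI, rule ccontr)
    fix x y assume xy: "x \<in> B" "y \<in> B" "v x = v y" "x \<noteq> y"
    let ?c = "\<lambda>b. if b = x then 1 else if b = y then -1 else 0"
    have "(\<Sum>b\<in>B. scale (?c b) (v b)) = (\<Sum>b\<in>{x,y}. scale (?c b) (v b))"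
      by (rule sum.mono_neutral_right) (use assms(1) xy in auto)
    also have "\<dots> = 0" using xy by auto
    finally show False using assms(2)[of ?c] xy by auto
  qed
  show "independent (v ` B)"
  proof (rule independent_if_scalars_zero)
    show "finite (v ` B)" using assms(1) by simp
    fix f x assume f: "(\<Sum>x\<in>v ` B. scale (f x) x) = 0" and x: "x \<in> v ` B"
    have "(\<Sum>b\<in>B. scale (f (v b)) (v b)) = 0"
      using f by (subst (asm) sum.reindex[OF inj]) simp
    then show "f x = 0" using assms(2)[of "\<lambda>b. f (v b)"] x by auto
  qed
qed

lemma span_image_finite_iff:
  assumes "finite B"
  shows "x \<in> span (v ` B) \<longleftrightarrow> (\<exists>c. x = (\<Sum>b\<in>B. scale (c b) (v b)))"
  using assms
proof (induction B arbitrary: x rule: finite_induct)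
  case (insert b B)
  have "x \<in> span (v ` insert b B) \<longleftrightarrow> (\<exists>k. x - scale k (v b) \<in> span (v ` B))"
    by (simp add: span_insert)
  also have "\<dots> \<longleftrightarrow> (\<exists>k c. x - scale k (v b) = (\<Sum>b\<in>B. scale (c b) (v b)))"
    using insert by simp
  also have "\<dots> \<longleftrightarrow> (\<exists>c. x = (\<Sum>b\<in>insert b B. scale (c b) (v b)))"
  proof
    assume "\<exists>k c. x - scale k (v b) = (\<Sum>b\<in>B. scale (c b) (v b))"
    then obtain k c where kc: "x - scale k (v b) = (\<Sum>b\<in>B. scale (c b) (v b))" by blast
    have "(\<Sum>i\<in>B. scale ((c(b := k)) i) (v i)) = (\<Sum>b\<in>B. scale (c b) (v b))"
      by (rule sum.cong) (use insert in auto)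
    then have "x = (\<Sum>i\<in>insert b B. scale ((c(b := k)) i) (v i))"
      using insert kc by (simp add: algebra_simps)
    then show "\<exists>c. x = (\<Sum>b\<in>insert b B. scale (c b) (v b))" by blast
  next
    assume "\<exists>c. x = (\<Sum>b\<in>insert b B. scale (c b) (v b))"
    then show "\<exists>k c. x - scale k (v b) = (\<Sum>b\<in>B. scale (c b) (v b))"
      using insert by (metis add_diff_cancel_left' sum.insert)
  qed
  finally show ?case .
qed simp

text \<open>Substitute for a quotient map: extend a basis of \<open>I\<close> to one of the whole
  space, send the former to 0 and fix the added vectors.\<close>

lemma exists_linear_with_kernel:
  assumes "subspace I"
  shows "\<exists>f. Vector_Spaces.linear scale scale f \<and> (\<forall>x. f x = 0 \<longleftrightarrow> x \<in> I)"
proof -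
  interpret vp: vector_space_pair scale scale by unfold_locales
  obtain B where B: "B \<subseteq> I" "independent B" "I \<subseteq> span B" "card B = dim I"
    by (rule basis_exists)
  have I: "I = span B" using B assms by (metis span_minimal subset_antisym)
  obtain C where C: "B \<subseteq> C" "independent C" "UNIV \<subseteq> span C"
    using maximal_independent_subset_extend[of B UNIV] B by auto
  define f where "f = vp.construct C (\<lambda>b. if b \<in> B then 0 else b)"
  have lf: "Vector_Spaces.linear scale scale f" unfolding f_def by (rule vp.linear_construct[OF C(2)])
  interpret f: Vector_Spaces.linear scale scale f by (rule lf)
  have fb: "f b = (if b \<in> B then 0 else b)" if "b \<in> C" for b
    unfolding f_def using vp.construct_basis[OF C(2) that] by simp
  have f0: "f x = 0" if "x \<in> span B" for x
    by (rule f.eq_0_on_span[OF _ that]) (use fb C in auto)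
  have fid: "f x = x" if "x \<in> span (C - B)" for x
    using vp.linear_eq_on[OF lf linear_id that] fb by simp
  have "x \<in> I" if "f x = 0" for x
  proof -
    have "x \<in> span (B \<union> (C - B))" using C by (metis UNIV_I Un_Diff_cancel Un_absorb1 subsetD)
    then obtain y z where yz: "x = y + z" "y \<in> span B" "z \<in> span (C - B)"
      unfolding span_Un by blast
    have "z = 0" using that f0[OF yz(2)] fid[OF yz(3)] yz(1) by (simp add: f.add)
    then show ?thesis using yz I by simp
  qed
  then show ?thesis using lf f0 I by blast
qed

end

text \<open>The kernel is taken inside \<open>V\<close>: the maps below live on an
  infinite-dimensional space, and only their restrictions to finite-dimensional subspaces are
  counted.\<close>

lemma (in vector_space_pair) rank_nullity:
  assumes lf: "Vector_Spaces.linear s1 s2 f" and V: "vs1.subspace V" "V \<subseteq> vs1.span F" "finite F"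
  shows "vs2.dim (f ` V) + vs1.dim {x \<in> V. f x = 0} = vs1.dim V"
proof -
  interpret f: Vector_Spaces.linear s1 s2 f by (rule lf)
  let ?K = "{x \<in> V. f x = 0}"
  obtain B where B: "B \<subseteq> ?K" "vs1.independent B" "?K \<subseteq> vs1.span B" "card B = vs1.dim ?K"
    by (rule vs1.basis_exists)
  obtain C where C: "B \<subseteq> C" "C \<subseteq> V" "vs1.independent C" "V \<subseteq> vs1.span C" "finite C" "card C = vs1.dim V"
    by (rule vs1.indep_extend_finite_basis[of B V F]) (use B V in auto)
  have finB: "finite B" using C(1,5) by (rule finite_subset)
  have inj0: "x = 0" if x: "x \<in> vs1.span (C - B)" "f x = 0" for x
  proof -
    have "x \<in> V" using x(1) C(2) V(1) by (meson Diff_subset subsetD subset_trans vs1.span_minimal)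
    then have "x \<in> vs1.span B" using B x by blast
    then obtain c where c: "x = (\<Sum>b\<in>B. c b *a b)"
      using vs1.span_image_finite_iff[of B x id] finB by auto
    obtain d where d: "x = (\<Sum>b\<in>C-B. d b *a b)"
      using vs1.span_image_finite_iff[of "C-B" x id] C x(1) by auto
    let ?e = "\<lambda>b. if b \<in> B then c b else - d b"
    have "(\<Sum>b\<in>C. ?e b *a b) = (\<Sum>b\<in>C-B. ?e b *a b) + (\<Sum>b\<in>B. ?e b *a b)"
      by (rule sum.subset_diff) (use C in auto)
    also have "(\<Sum>b\<in>B. ?e b *a b) = x" unfolding c by (rule sum.cong) auto
    also have "(\<Sum>b\<in>C-B. ?e b *a b) = (\<Sum>b\<in>C-B. - (d b *a b))" by (rule sum.cong) auto
    also have "\<dots> = - x" unfolding d by (simp add: sum_negf)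
    finally have e0: "(\<Sum>b\<in>C. ?e b *a b) = 0" by simp
    have "?e b = 0" if "b \<in> C" for b
      by (rule vs1.independentD[OF C(3) C(5) order_refl e0 that])
    then have "\<forall>b\<in>B. c b = 0" using C(1) by (metis subsetD)
    then show ?thesis using c by simp
  qed
  have "inj_on f (vs1.span (C - B))"
    using inj0 by (simp add: linear_inj_on_iff_eq_0[OF lf])
  then have ind: "vs2.independent (f ` (C - B))"
    using C(3) by (meson Diff_subset f.independent_injective_image vs1.independent_mono)
  have inj: "inj_on f (C - B)"
    using \<open>inj_on f (vs1.span (C - B))\<close> by (meson inj_on_subset vs1.span_superset)
  have "f ` V \<subseteq> vs2.span (f ` (C - B))"
  proof
    fix y assume "y \<in> f ` V"
    then obtain x where x: "x \<in> V" "y = f x" by blast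
    have "x \<in> vs1.span (B \<union> (C - B))" using C x by (metis Un_Diff_cancel Un_absorb1 subsetD)
    then obtain a b where ab: "x = a + b" "a \<in> vs1.span B" "b \<in> vs1.span (C - B)"
      unfolding vs1.span_Un by blast
    have "f a = 0" by (rule f.eq_0_on_span[OF _ ab(2)]) (use B in auto)
    then show "y \<in> vs2.span (f ` (C - B))" using ab x by (simp add: f.add f.span_image)
  qed
  moreover have "f ` (C - B) \<subseteq> f ` V" using C by auto
  ultimately have "vs2.dim (f ` V) = card (f ` (C - B))"
    using ind by (metis vs2.basis_card_eq_dim)
  also have "\<dots> = card C - card B"
    using inj C by (simp add: card_image card_Diff_subset finite_subset)
  finally show ?thesis using B(4) C(6) card_mono[OF C(5,1)] by simp
qed

section \<open>The polynomial ring as a vector space\<close>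

hide_const (open) Polynomial.monom
hide_fact (open) Polynomial.monom_def

text \<open>As multiplication by a constant polynomial, scaling preserves every ideal by the
  definition of an ideal.\<close>

definition scal :: "'a::comm_ring_1 \<Rightarrow> 'a poly3 \<Rightarrow> 'a poly3" where
  "scal c p = Poly_Mapping.single 0 c * p"

lemma lookup_scal [simp]: "Poly_Mapping.lookup (scal c p) a = c * Poly_Mapping.lookup p a"
  unfolding scal_def mult_map_scale_conv_mult[symmetric]
  by (simp add: Poly_Mapping.map.rep_eq when_def)

lemma scal_single [simp]: "scal c (Poly_Mapping.single a d) = Poly_Mapping.single a (c * d)"
  by (simp add: scal_def mult_single)

lemma scal_mult_left: "scal c p * q = scal c (p * q)"
  by (simp add: scal_def mult.assoc)

lemma scal_mult_right: "p * scal c q = scal c (p * q)"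
  by (simp add: scal_def mult.left_commute)

lemma scal_add_right: "scal c (p + q) = scal c p + scal c q"
  by (simp add: scal_def distrib_left)

lemma scal_scal [simp]: "scal c (scal d p) = scal (c * d) p"
  by (rule poly_mapping_eqI) (simp add: mult.assoc)

lemma scal_1 [simp]: "scal 1 p = p"
  by (rule poly_mapping_eqI) simp

lemma scal_0_left [simp]: "scal 0 p = 0"
  by (rule poly_mapping_eqI) simp

lemma scal_0_right [simp]: "scal c 0 = 0"
  by (rule poly_mapping_eqI) simp

interpretation PV: vector_space "scal :: 'a::field \<Rightarrow> 'a poly3 \<Rightarrow> 'a poly3"
  by unfold_locales (auto simp: scal_add_right intro!: poly_mapping_eqI simp: lookup_add algebra_simps)

interpretation PP: vector_space_pair "scal :: 'a::field \<Rightarrow> 'a poly3 \<Rightarrow> 'a poly3" scal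
  by unfold_locales

lemma sum_single_lookup:
  assumes "finite A" "Poly_Mapping.keys p \<subseteq> A"
  shows "(\<Sum>a\<in>A. Poly_Mapping.single a (Poly_Mapping.lookup p a)) = p"
proof (rule poly_mapping_eqI)
  fix k
  have "Poly_Mapping.lookup (\<Sum>a\<in>A. Poly_Mapping.single a (Poly_Mapping.lookup p a)) k
      = (\<Sum>a\<in>A. if a = k then Poly_Mapping.lookup p a else 0)"
    by (simp add: lookup_sum lookup_single when_def)
  also have "\<dots> = Poly_Mapping.lookup p k"
    using assms by (auto simp: in_keys_iff)
  finally show "Poly_Mapping.lookup (\<Sum>a\<in>A. Poly_Mapping.single a (Poly_Mapping.lookup p a)) k
      = Poly_Mapping.lookup p k" .
qed

lemma poly_mapping_single_induct [case_names zero single add]: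
  fixes p :: "'a \<Rightarrow>\<^sub>0 'b::comm_monoid_add"
  assumes "P 0" "\<And>a c. P (Poly_Mapping.single a c)" "\<And>p q. P p \<Longrightarrow> P q \<Longrightarrow> P (p + q)"
  shows "P p"
proof -
  have "P (\<Sum>a\<in>A. Poly_Mapping.single a (Poly_Mapping.lookup p a))" if "finite A" for A
    using that by induction (auto intro: assms)
  then show ?thesis using sum_single_lookup[of "Poly_Mapping.keys p" p] by (metis finite_keys order_refl)
qed

lemma single_eq_scal_monom: "Poly_Mapping.single a c = scal c (monom a)"
  by (simp add: monom_def)

lemma sum_scal_monom:
  assumes "finite A" "Poly_Mapping.keys p \<subseteq> A"
  shows "(\<Sum>a\<in>A. scal (Poly_Mapping.lookup p a) (monom a)) = p"
  using sum_single_lookup[OF assms] by (simp add: single_eq_scal_monom)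

lemma monom_add: "monom (a + b) = (monom a * monom b :: 'a::comm_ring_1 poly3)"
  by (simp add: monom_def mult_single)

lemma monom_zero: "monom 0 = (1 :: 'a::comm_ring_1 poly3)"
  by (simp add: monom_def)

subsection \<open>Linear substitutions\<close>

definition mon_subst :: "(nat \<Rightarrow> nat \<Rightarrow> 'a::comm_ring_1) \<Rightarrow> mon3 \<Rightarrow> 'a poly3" where
  "mon_subst M a = lin_form M 0 ^ fst a * lin_form M 1 ^ fst (snd a) * lin_form M 2 ^ snd (snd a)"

lemma mon_subst_add: "mon_subst M (a + b) = mon_subst M a * mon_subst M b"
  by (simp add: mon_subst_def power_add algebra_simps)

lemma mon_subst_0: "mon_subst M 0 = 1"
  by (simp add: mon_subst_def)

text \<open>Summing over any finite superset of the support lets several polynomials share one index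
  set, as additivity requires.\<close>

lemma subst3_alt:
  assumes "finite A" "Poly_Mapping.keys f \<subseteq> A"
  shows "subst3 M f = (\<Sum>a\<in>A. scal (Poly_Mapping.lookup f a) (mon_subst M a))"
proof -
  have "subst3 M f = (\<Sum>a\<in>Poly_Mapping.keys f. scal (Poly_Mapping.lookup f a) (mon_subst M a))"
    by (simp add: subst3_def scal_def mon_subst_def zero_prod_def mult.assoc)
  also have "\<dots> = (\<Sum>a\<in>A. scal (Poly_Mapping.lookup f a) (mon_subst M a))"
    by (rule sum.mono_neutral_left) (use assms in \<open>auto simp: in_keys_iff\<close>)
  finally show ?thesis .
qed

lemma scal_add_left: "scal (c + d) p = scal c p + scal d p"
  by (rule poly_mapping_eqI) (simp add: lookup_add algebra_simps)

lemma subst3_single: "subst3 M (Poly_Mapping.single a c) = scal c (mon_subst M a)"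
  by (subst subst3_alt[of "{a}"]) auto

lemma subst3_add: "subst3 M (f + g) = subst3 M f + subst3 M g"
proof -
  let ?A = "Poly_Mapping.keys f \<union> Poly_Mapping.keys g"
  have "Poly_Mapping.keys (f + g) \<subseteq> ?A" by (rule keys_add)
  then show ?thesis
    by (simp add: subst3_alt[of ?A] lookup_add scal_add_left sum.distrib)
qed

lemma subst3_0 [simp]: "subst3 M 0 = 0"
  by (simp add: subst3_def)

lemma subst3_scal: "subst3 M (scal c f) = scal c (subst3 M f)"
  by (induction f rule: poly_mapping_single_induct)
    (simp_all add: subst3_single subst3_add scal_add_right)

lemma subst3_mult: "subst3 M (f * g) = subst3 M f * subst3 M g"
proof (induction f rule: poly_mapping_single_induct)
  case (single a c)
  show ?case
    by (induction g rule: poly_mapping_single_induct)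
      (simp_all add: mult_single subst3_single mon_subst_add scal_mult_left scal_mult_right
        distrib_left subst3_add mult.commute[of c])
qed (simp_all add: distrib_right subst3_add)

lemma subst3_1 [simp]: "subst3 M 1 = 1"
  using subst3_single[of M 0 1] by (simp add: mon_subst_0)

lemma subst3_power: "subst3 M (f ^ n) = subst3 M f ^ n"
  by (induction n) (simp_all add: subst3_mult)

lemma subst3_monom: "subst3 M (monom a) = mon_subst M a"
  by (simp add: monom_def subst3_single)

lemma subst3_sum: "subst3 M (sum f A) = (\<Sum>a\<in>A. subst3 M (f a))"
  by (induction A rule: infinite_finite_induct) (simp_all add: subst3_add)

lemma linear_subst3: "Vector_Spaces.linear scal scal (subst3 (M :: nat \<Rightarrow> nat \<Rightarrow> 'a::field))"
  unfolding Vector_Spaces.linear_iff by (simp add: subst3_add subst3_scal PV.vector_space_axioms)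

lemma lin_form_alt: "lin_form M j = scal (M 0 j) (monom (1,0,0)) + scal (M 1 j) (monom (0,1,0)) + scal (M 2 j) (monom (0,0,1))"
  by (simp add: lin_form_def scal_def var3_def eval_nat_numeral zero_prod_def)

lemma monom_eq_powers:
  "(monom (i,j,k) :: 'a::comm_ring_1 poly3) = monom (1,0,0) ^ i * monom (0,1,0) ^ j * monom (0,0,1) ^ k"
proof -
  have p: "(monom a ^ n :: 'a poly3) = monom (n * fst a, n * fst (snd a), n * snd (snd a))" for a n
    by (induction n) (simp_all add: monom_zero[symmetric] zero_prod_def monom_add[symmetric] plus_prod_def)
  show ?thesis by (simp add: p monom_add[symmetric])
qed

definition mat_mul :: "(nat \<Rightarrow> nat \<Rightarrow> 'a::comm_ring_1) \<Rightarrow> (nat \<Rightarrow> nat \<Rightarrow> 'a) \<Rightarrow> nat \<Rightarrow> nat \<Rightarrow> 'a" where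
  "mat_mul M N i j = (\<Sum>k<3. M i k * N k j)"

text \<open>Column j of a matrix holds the image of the j-th variable, so substitutions compose in
  the order of the matrix product.\<close>

lemma subst3_lin_form: "subst3 M (lin_form N j) = lin_form (mat_mul M N) j"
proof -
  have *: "mon_subst M (1,0,0) = lin_form M 0" "mon_subst M (0,1,0) = lin_form M 1"
    "mon_subst M (0,0,1) = lin_form M 2" by (simp_all add: mon_subst_def)
  have "subst3 M (lin_form N j) = scal (N 0 j) (lin_form M 0) + scal (N 1 j) (lin_form M 1) + scal (N 2 j) (lin_form M 2)"
    unfolding lin_form_alt[of N] by (simp only: subst3_add subst3_scal subst3_monom *)
  also have "\<dots> = lin_form (mat_mul M N) j"
    unfolding lin_form_alt mat_mul_def
    by (rule poly_mapping_eqI) (simp add: lookup_add algebra_simps eval_nat_numeral)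
  finally show ?thesis .
qed

lemma subst3_subst3: "subst3 M (subst3 N f) = subst3 (mat_mul M N) f"
proof (induction f rule: poly_mapping_single_induct)
  case (single a c)
  show ?case
    by (simp add: subst3_single subst3_scal mon_subst_def subst3_mult subst3_power subst3_lin_form)
qed (simp_all add: subst3_add)

lemma subst3_cong:
  assumes "\<And>i j. i < 3 \<Longrightarrow> j < 3 \<Longrightarrow> M i j = N i j"
  shows "subst3 M f = subst3 N f"
proof -
  have "lin_form M j = lin_form N j" if "j < 3" for j
    using assms that by (simp add: lin_form_alt)
  then have "mon_subst M = mon_subst N" by (simp add: mon_subst_def fun_eq_iff)
  then show ?thesis by (simp add: subst3_alt[OF finite_keys order_refl])
qed

lemma subst3_scalar_matrix_single:
  assumes "\<And>i j. i < 3 \<Longrightarrow> j < 3 \<Longrightarrow> M i j = (if i = j then c else 0)"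
  shows "subst3 M (Poly_Mapping.single a d) = Poly_Mapping.single a (c ^ mdeg a * d)"
proof -
  obtain i j k where a: "a = (i,j,k)" by (cases a)
  have l: "lin_form M 0 = scal c (monom (1,0,0))" "lin_form M 1 = scal c (monom (0,1,0))"
    "lin_form M 2 = scal c (monom (0,0,1))"
    using assms by (simp_all add: lin_form_alt)
  have p: "scal c f ^ n = scal (c ^ n) (f ^ n)" for n and f :: "'a poly3"
    by (induction n) (simp_all add: scal_mult_left scal_mult_right mult.commute)
  have "mon_subst M a = scal (c ^ mdeg a) (monom a)"
    unfolding a by (subst monom_eq_powers) (simp only: mon_subst_def l p fst_conv snd_conv scal_mult_left scal_mult_right scal_scal mdeg_def
        power_add mult.commute mult.left_commute)
  then show ?thesis by (simp add: subst3_single monom_def mult.commute)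
qed

lemma lookup_subst3_scalar_matrix:
  assumes "\<And>i j. i < 3 \<Longrightarrow> j < 3 \<Longrightarrow> M i j = (if i = j then c else 0)"
  shows "Poly_Mapping.lookup (subst3 M f) a = c ^ mdeg a * Poly_Mapping.lookup f a"
proof (induction f rule: poly_mapping_single_induct)
  case (single b d)
  have "subst3 M (Poly_Mapping.single b d) = Poly_Mapping.single b (c ^ mdeg b * d)"
    by (rule subst3_scalar_matrix_single) (rule assms)
  then show ?case by (simp add: lookup_single when_def)
qed (simp_all add: subst3_add lookup_add algebra_simps)

text \<open>The transposed cofactor matrix, for indices below 3. Unlike those of the inverse, its
  entries are polynomials in the entries of \<open>M\<close>.\<close>

definition adj3 :: "(nat \<Rightarrow> nat \<Rightarrow> 'a::comm_ring_1) \<Rightarrow> nat \<Rightarrow> nat \<Rightarrow> 'a" where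
  "adj3 M i j =
    [[M 1 1 * M 2 2 - M 1 2 * M 2 1, M 0 2 * M 2 1 - M 0 1 * M 2 2, M 0 1 * M 1 2 - M 0 2 * M 1 1],
     [M 1 2 * M 2 0 - M 1 0 * M 2 2, M 0 0 * M 2 2 - M 0 2 * M 2 0, M 0 2 * M 1 0 - M 0 0 * M 1 2],
     [M 1 0 * M 2 1 - M 1 1 * M 2 0, M 0 1 * M 2 0 - M 0 0 * M 2 1, M 0 0 * M 1 1 - M 0 1 * M 1 0]]
    ! i ! j"

lemma less_3_cases: "i < (3::nat) \<longleftrightarrow> i = 0 \<or> i = 1 \<or> i = 2"
  by auto

lemma mat_mul_adj3:
  assumes "i < 3" "j < 3"
  shows "mat_mul M (adj3 M) i j = (if i = j then det3 M else 0)"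
    and "mat_mul (adj3 M) M i j = (if i = j then det3 M else 0)"
proof -
  have s: "(\<Sum>k<3. f k) = f 0 + f 1 + f 2" for f :: "nat \<Rightarrow> 'a"
    by (simp add: eval_nat_numeral)
  have adj: "adj3 M 0 0 = M 1 1 * M 2 2 - M 1 2 * M 2 1" "adj3 M 0 1 = M 0 2 * M 2 1 - M 0 1 * M 2 2"
    "adj3 M 0 2 = M 0 1 * M 1 2 - M 0 2 * M 1 1"
    "adj3 M 1 0 = M 1 2 * M 2 0 - M 1 0 * M 2 2" "adj3 M 1 1 = M 0 0 * M 2 2 - M 0 2 * M 2 0"
    "adj3 M 1 2 = M 0 2 * M 1 0 - M 0 0 * M 1 2"
    "adj3 M 2 0 = M 1 0 * M 2 1 - M 1 1 * M 2 0" "adj3 M 2 1 = M 0 1 * M 2 0 - M 0 0 * M 2 1"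
    "adj3 M 2 2 = M 0 0 * M 1 1 - M 0 1 * M 1 0"
    by (simp_all add: adj3_def)
  show "mat_mul M (adj3 M) i j = (if i = j then det3 M else 0)"
    "mat_mul (adj3 M) M i j = (if i = j then det3 M else 0)"
    using assms unfolding less_3_cases mat_mul_def s
    by (elim disjE; hypsubst; simp only: adj det3_def; simp add: algebra_simps)+
qed

section \<open>Homogeneous components\<close>

definition hcomp :: "nat \<Rightarrow> 'a::zero poly3 \<Rightarrow> 'a poly3" where
  "hcomp e p = Poly_Mapping.mapp (\<lambda>a c. c when mdeg a = e) p"

lemma lookup_hcomp: "Poly_Mapping.lookup (hcomp e p) a = (Poly_Mapping.lookup p a when mdeg a = e)"
  by (auto simp: hcomp_def lookup_mapp when_def in_keys_iff)

lemma mdeg_add [simp]: "mdeg (a + b) = mdeg a + mdeg b"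
  by (simp add: mdeg_def)

lemma mdeg_Pair [simp]: "mdeg (i, j, k) = i + j + k"
  by (simp add: mdeg_def)

lemma hcomp_0 [simp]: "hcomp e 0 = 0"
  by (rule poly_mapping_eqI) (simp add: lookup_hcomp)

lemma hcomp_add: "hcomp e (p + q) = hcomp e p + hcomp e (q :: 'a::comm_ring_1 poly3)"
  by (rule poly_mapping_eqI) (simp add: lookup_hcomp lookup_add when_def)

lemma hcomp_single: "hcomp e (Poly_Mapping.single a c) = (if mdeg a = e then Poly_Mapping.single a c else 0)"
  by (rule poly_mapping_eqI) (auto simp: lookup_hcomp lookup_single when_def)

lemma homogeneous_iff: "homogeneous d f \<longleftrightarrow> (\<forall>a. Poly_Mapping.lookup f a \<noteq> 0 \<longrightarrow> mdeg a = d)"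
  unfolding homogeneous_def by (metis in_keys_iff)

lemma homogeneous_0 [simp]: "homogeneous d 0"
  by (simp add: homogeneous_def)

lemma homogeneous_1 [simp]: "homogeneous 0 (1 :: 'a::comm_ring_1 poly3)"
  by (auto simp: homogeneous_def zero_prod_def)

lemma homogeneous_add: "homogeneous d f \<Longrightarrow> homogeneous d g \<Longrightarrow> homogeneous d (f + g :: 'a::comm_ring_1 poly3)"
  unfolding homogeneous_iff lookup_add by (metis add_0)

lemma homogeneous_scal: "homogeneous d f \<Longrightarrow> homogeneous d (scal c f)"
  unfolding homogeneous_iff by (metis lookup_scal mult_zero_right)

lemma homogeneous_monom [simp]: "homogeneous d (monom a :: 'a::comm_ring_1 poly3) \<longleftrightarrow> mdeg a = d"
  by (auto simp: homogeneous_def monom_def)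

lemma homogeneous_mult:
  assumes "homogeneous d f" "homogeneous e (g :: 'a::comm_ring_1 poly3)"
  shows "homogeneous (d + e) (f * g)"
proof -
  have "mdeg a = d + e" if k: "a \<in> Poly_Mapping.keys (f * g)" for a
  proof -
    obtain b c where "a = b + c" "b \<in> Poly_Mapping.keys f" "c \<in> Poly_Mapping.keys g"
      using subsetD[OF keys_mult k] by blast
    then show ?thesis using assms by (simp add: homogeneous_def)
  qed
  then show ?thesis unfolding homogeneous_def by blast
qed

lemma homogeneous_power:
  "homogeneous d (f :: 'a::comm_ring_1 poly3) \<Longrightarrow> homogeneous (n * d) (f ^ n)"
  by (induction n) (auto intro: homogeneous_mult)

lemma homogeneous_sum:
  "(\<And>a. a \<in> A \<Longrightarrow> homogeneous d (f a)) \<Longrightarrow> homogeneous d (\<Sum>a\<in>A. f a :: 'a::comm_ring_1 poly3)"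
  by (induction A rule: infinite_finite_induct) (auto intro: homogeneous_add)

lemma homogeneous_hcomp [simp]: "homogeneous e (hcomp e p)"
  by (auto simp: homogeneous_iff lookup_hcomp when_def)

lemma hcomp_homogeneous: "homogeneous d p \<Longrightarrow> hcomp e p = (if e = d then p else 0)"
proof (rule poly_mapping_eqI)
  fix a assume "homogeneous d p"
  then have "Poly_Mapping.lookup p a = 0 \<or> mdeg a = d" unfolding homogeneous_iff by blast
  then show "Poly_Mapping.lookup (hcomp e p) a = Poly_Mapping.lookup (if e = d then p else 0) a"
    by (elim disjE) (simp_all add: lookup_hcomp when_def)
qed

lemma homogeneous_lin_form: "homogeneous 1 (lin_form M j)"
  unfolding lin_form_alt by (intro homogeneous_add homogeneous_scal) simp_all

lemma homogeneous_mon_subst: "homogeneous (mdeg a) (mon_subst M a)"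
proof -
  have "homogeneous (fst a * 1 + fst (snd a) * 1 + snd (snd a) * 1) (mon_subst M a)"
    unfolding mon_subst_def
    by (intro homogeneous_mult homogeneous_power homogeneous_lin_form)
  then show ?thesis by (simp add: mdeg_def)
qed

lemma hcomp_scal: "hcomp e (scal c p) = scal c (hcomp e p)"
  by (rule poly_mapping_eqI) (simp add: lookup_hcomp when_def)

lemma hcomp_subst3: "hcomp e (subst3 M p) = subst3 M (hcomp e p)"
proof (induction p rule: poly_mapping_single_induct)
  case (single a c)
  show ?case
    by (simp add: subst3_single hcomp_scal hcomp_single hcomp_homogeneous[OF homogeneous_mon_subst])
qed (simp_all add: subst3_add hcomp_add)

lemma homogeneous_subst3: "homogeneous d p \<Longrightarrow> homogeneous d (subst3 M p)"
  by (metis hcomp_subst3 hcomp_homogeneous homogeneous_hcomp)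

lemma hcomp_mult_homogeneous:
  assumes "homogeneous d (f :: 'a::comm_ring_1 poly3)"
  shows "hcomp e (g * f) = (if d \<le> e then hcomp (e - d) g * f else 0)"
proof (induction g rule: poly_mapping_single_induct)
  case (single a c)
  have "homogeneous (mdeg a + d) (Poly_Mapping.single a c * f)"
    by (rule homogeneous_mult[OF _ assms]) (simp add: homogeneous_def)
  then show ?case by (auto simp: hcomp_homogeneous hcomp_single)
qed (simp_all add: hcomp_add distrib_right)

subsection \<open>Ideals\<close>

definition is_ideal :: "'a::comm_ring_1 poly3 set \<Rightarrow> bool" where
  "is_ideal I \<longleftrightarrow> 0 \<in> I \<and> (\<forall>p\<in>I. \<forall>q\<in>I. p + q \<in> I) \<and> (\<forall>p\<in>I. \<forall>q. q * p \<in> I)"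

definition graded_ideal :: "'a::comm_ring_1 poly3 set \<Rightarrow> bool" where
  "graded_ideal I \<longleftrightarrow> is_ideal I \<and> (\<forall>p\<in>I. \<forall>e. hcomp e p \<in> I)"

lemma is_idealD:
  assumes "is_ideal I"
  shows "0 \<in> I" "p \<in> I \<Longrightarrow> q \<in> I \<Longrightarrow> p + q \<in> I" "p \<in> I \<Longrightarrow> r * p \<in> I"
    "p \<in> I \<Longrightarrow> scal c p \<in> I" "p \<in> I \<Longrightarrow> q \<in> I \<Longrightarrow> p - q \<in> I"
proof -
  show *: "0 \<in> I" "p \<in> I \<Longrightarrow> q \<in> I \<Longrightarrow> p + q \<in> I" "p \<in> I \<Longrightarrow> r * p \<in> I" for p q r
    using assms by (auto simp: is_ideal_def)
  show "p \<in> I \<Longrightarrow> scal c p \<in> I" by (simp add: scal_def *)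
  show "p \<in> I \<Longrightarrow> q \<in> I \<Longrightarrow> p - q \<in> I" using *(2)[of p "-1 * q"] *(3)[of q "-1"] by simp
qed

lemma is_ideal_sum:
  "is_ideal I \<Longrightarrow> (\<And>a. a \<in> A \<Longrightarrow> f a \<in> I) \<Longrightarrow> (\<Sum>a\<in>A. f a) \<in> I"
  by (induction A rule: infinite_finite_induct) (auto simp: is_idealD)

lemma is_ideal_subspace: "is_ideal (I :: 'a::field poly3 set) \<Longrightarrow> PV.subspace I"
  by (auto simp: PV.subspace_def is_idealD)

lemma sum_in_ideal_gen:
  assumes "\<And>i. i < (n::nat) \<Longrightarrow> g i \<in> G"
  shows "(\<Sum>i<n. c i * g i) \<in> ideal_gen G"
  using assms unfolding ideal_gen_def by blast

lemma is_ideal_ideal_gen: "is_ideal (ideal_gen G)"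
  unfolding is_ideal_def
proof (intro conjI ballI allI)
  show "0 \<in> ideal_gen G" using sum_in_ideal_gen[of 0 _ G] by simp
next
  fix p q assume "p \<in> ideal_gen G" "q \<in> ideal_gen G"
  then obtain n c g m c' g' where
    p: "p = (\<Sum>i<(n::nat). c i * g i)" "\<forall>i<n. g i \<in> G" and
    q: "q = (\<Sum>i<(m::nat). c' i * g' i)" "\<forall>i<m. g' i \<in> G"
    unfolding ideal_gen_def by blast
  let ?c = "\<lambda>i. if i < n then c i else c' (i - n)"
  let ?g = "\<lambda>i. if i < n then g i else g' (i - n)"
  have "(\<Sum>i<n+m. ?c i * ?g i) = (\<Sum>i<n. ?c i * ?g i) + (\<Sum>i=n..<n+m. ?c i * ?g i)"
    using sum.atLeastLessThan_concat[of 0 n "n+m" "\<lambda>i. ?c i * ?g i"] by (simp only: lessThan_atLeast0)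
  also have "(\<Sum>i=n..<n+m. ?c i * ?g i) = (\<Sum>i<m. ?c (i+n) * ?g (i+n))"
    using sum.shift_bounds_nat_ivl[of "\<lambda>i. ?c i * ?g i" 0 n m] by (simp add: lessThan_atLeast0 add.commute)
  finally have "p + q = (\<Sum>i<n+m. ?c i * ?g i)" by (simp add: p q)
  also have "\<dots> \<in> ideal_gen G" by (rule sum_in_ideal_gen) (use p q in auto)
  finally show "p + q \<in> ideal_gen G" .
next
  fix p q assume "p \<in> ideal_gen G"
  then obtain n c g where p: "p = (\<Sum>i<(n::nat). c i * g i)" "\<forall>i<n. g i \<in> G"
    unfolding ideal_gen_def by blast
  have "q * p = (\<Sum>i<n. (q * c i) * g i)" by (simp add: p sum_distrib_left mult.assoc)
  also have "\<dots> \<in> ideal_gen G" by (rule sum_in_ideal_gen) (use p in auto)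
  finally show "q * p \<in> ideal_gen G" .
qed

lemma in_ideal_gen: "g \<in> G \<Longrightarrow> g \<in> ideal_gen G"
  using sum_in_ideal_gen[of 1 "\<lambda>_. g" G "\<lambda>_. 1"] by simp

lemma ideal_gen_minimal:
  assumes "is_ideal I" "G \<subseteq> I"
  shows "ideal_gen G \<subseteq> I"
  using assms unfolding ideal_gen_def by (auto intro!: is_ideal_sum is_idealD(3))

lemma ideal_gen_empty [simp]: "ideal_gen {} = {0 :: 'a::comm_ring_1 poly3}"
  using ideal_gen_minimal[of "{0}" "{}"] is_idealD(1)[OF is_ideal_ideal_gen[of "{}"]]
  by (auto simp: is_ideal_def)

lemma ideal_gen_insert: "ideal_gen (insert f G) = {q + g * f | q g. q \<in> ideal_gen G}"
proof (rule subset_antisym)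
  let ?R = "{q + g * f | q g. q \<in> ideal_gen G}"
  have "is_ideal ?R"
    unfolding is_ideal_def
  proof (intro conjI ballI allI)
    show "0 \<in> ?R" using is_idealD(1)[OF is_ideal_ideal_gen[of G]] by (intro CollectI exI[of _ 0]) simp
  next
    fix p q assume "p \<in> ?R" "q \<in> ?R"
    then obtain p1 g1 q1 g2 where *: "p = p1 + g1 * f" "q = q1 + g2 * f" "p1 \<in> ideal_gen G" "q1 \<in> ideal_gen G"
      by blast
    have "p + q = (p1 + q1) + (g1 + g2) * f" by (simp add: * algebra_simps)
    then show "p + q \<in> ?R" using * is_idealD(2)[OF is_ideal_ideal_gen] by blast
  next
    fix p q assume "p \<in> ?R"
    then obtain p1 g1 where *: "p = p1 + g1 * f" "p1 \<in> ideal_gen G" by blast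
    have "q * p = q * p1 + (q * g1) * f" by (simp add: * algebra_simps)
    then show "q * p \<in> ?R" using * is_idealD(3)[OF is_ideal_ideal_gen] by blast
  qed
  moreover have "insert f G \<subseteq> ?R"
  proof -
    have "0 + 1 * f \<in> ?R" using is_idealD(1)[OF is_ideal_ideal_gen[of G]] by blast
    moreover have "g + 0 * f \<in> ?R" if "g \<in> G" for g using in_ideal_gen[OF that] by blast
    ultimately show ?thesis by fastforce
  qed
  ultimately show "ideal_gen (insert f G) \<subseteq> ?R" by (rule ideal_gen_minimal)
  have "ideal_gen G \<subseteq> ideal_gen (insert f G)"
    by (rule ideal_gen_minimal) (auto simp: is_ideal_ideal_gen in_ideal_gen)
  then show "?R \<subseteq> ideal_gen (insert f G)"
    using is_idealD(2,3)[OF is_ideal_ideal_gen[of "insert f G"]] in_ideal_gen[of f "insert f G"] by auto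
qed

lemma graded_ideal_empty: "graded_ideal (ideal_gen {})"
  using is_ideal_ideal_gen[of "{}"] by (auto simp: graded_ideal_def)

lemma graded_ideal_insert:
  assumes "graded_ideal (ideal_gen G)" "homogeneous d f"
  shows "graded_ideal (ideal_gen (insert f G))"
  unfolding graded_ideal_def
proof (intro conjI ballI allI)
  fix p e assume "p \<in> ideal_gen (insert f G)"
  then obtain q g where p: "p = q + g * f" "q \<in> ideal_gen G" unfolding ideal_gen_insert by blast
  have "hcomp e p = hcomp e q + (if d \<le> e then hcomp (e - d) g else 0) * f"
    by (simp add: p hcomp_add hcomp_mult_homogeneous[OF assms(2)])
  moreover have "hcomp e q \<in> ideal_gen G" using assms(1) p by (auto simp: graded_ideal_def)
  ultimately show "hcomp e p \<in> ideal_gen (insert f G)" unfolding ideal_gen_insert by blast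
qed (rule is_ideal_ideal_gen)

subsection \<open>Hilbert functions\<close>

definition mons :: "nat \<Rightarrow> mon3 set" where
  "mons t = {a. mdeg a = t}"

definition hspace :: "nat \<Rightarrow> 'a::field poly3 set" where
  "hspace t = {p. homogeneous t p}"

lemma mons_eq: "mons t = (\<lambda>(s,i). (i, s - i, t - s)) ` (SIGMA s:{..t}. {..s})"
proof (intro subset_antisym subsetI)
  fix a assume "a \<in> mons t"
  then obtain i j k where a: "a = (i,j,k)" "i + j + k = t"
    by (cases a) (auto simp: mons_def)
  have "a = (\<lambda>(s,i). (i, s - i, t - s)) (i+j, i)" using a by simp
  moreover have "(i+j, i) \<in> (SIGMA s:{..t}. {..s})" using a by simp
  ultimately show "a \<in> (\<lambda>(s,i). (i, s - i, t - s)) ` (SIGMA s:{..t}. {..s})" by blast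
qed (auto simp: mons_def)

lemma finite_mons [simp]: "finite (mons t)"
  unfolding mons_eq by (intro finite_imageI finite_SigmaI) auto

text \<open>Sorting by the degree s in the first two variables turns the count into the sum of all s
  + 1. The factor 2 avoids dividing natural numbers.\<close>

lemma card_mons: "2 * card (mons t) = (t + 1) * (t + 2)"
proof -
  have "inj_on (\<lambda>(s,i). (i, s - i, t - s)) (SIGMA s:{..t}. {..s})"
    by (auto simp: inj_on_def)
  then have "card (mons t) = card (SIGMA s:{..t}. {..s})"
    unfolding mons_eq by (rule card_image)
  also have "\<dots> = (\<Sum>s\<le>t. Suc s)" by simp
  finally have "card (mons t) = (\<Sum>s\<le>t. Suc s)" .
  moreover have "2 * (\<Sum>s\<le>t. Suc s) = (t + 1) * (t + 2)"
    by (induction t) simp_all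
  ultimately show ?thesis by simp
qed

lemma hspace_subspace [simp]: "PV.subspace (hspace t)"
  unfolding PV.subspace_def hspace_def by (simp add: homogeneous_add homogeneous_scal)

lemma hspace_eq_span: "(hspace t :: 'a::field poly3 set) = PV.span (monom ` mons t)"
proof (rule subset_antisym)
  show "PV.span (monom ` mons t) \<subseteq> hspace t"
    by (rule PV.span_minimal[OF _ hspace_subspace]) (auto simp: hspace_def mons_def)
  show "(hspace t :: 'a poly3 set) \<subseteq> PV.span (monom ` mons t)"
  proof (rule subsetI)
    fix p :: "'a poly3" assume "p \<in> hspace t"
    then have "Poly_Mapping.keys p \<subseteq> mons t" by (auto simp: hspace_def homogeneous_def mons_def)
    then have "p = (\<Sum>a\<in>mons t. scal (Poly_Mapping.lookup p a) (monom a))"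
      by (simp add: sum_scal_monom)
    then show "p \<in> PV.span (monom ` mons t)"
      using PV.span_image_finite_iff[OF finite_mons] by blast
  qed
qed

lemma dim_hspace: "PV.dim (hspace t :: 'a::field poly3 set) = card (mons t)"
proof -
  have lk: "Poly_Mapping.lookup (\<Sum>b\<in>A. scal (c b) (monom b)) a = c a" if "finite A" "a \<in> A"
    for c :: "mon3 \<Rightarrow> 'a" and a A
    using that by (simp add: lookup_sum monom_def lookup_single when_def)
  have z: "\<forall>b\<in>mons t. c b = 0" if "(\<Sum>b\<in>mons t. scal (c b) (monom b)) = (0 :: 'a poly3)" for c
    using lk[of "mons t" _ c] that by simp
  have "PV.dim (hspace t :: 'a poly3 set) = card (monom ` mons t :: 'a poly3 set)"
    unfolding hspace_eq_span
    by (rule PV.dim_span_eq_card_independent, rule PV.independent_family(2)) (use z in auto)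
  also have "\<dots> = card (mons t)"
    by (rule card_image, rule PV.independent_family(1)) (use z in auto)
  finally show ?thesis .
qed

text \<open>Stands in for the map from S to S/I. The choice is harmless: only linearity and the
  kernel are ever used, for \<open>I\<close> a subspace.\<close>

definition proj :: "'a::field poly3 set \<Rightarrow> 'a poly3 \<Rightarrow> 'a poly3" where
  "proj I = (SOME f. Vector_Spaces.linear scal scal f \<and> (\<forall>x. f x = 0 \<longleftrightarrow> x \<in> I))"

definition rk :: "'a::field poly3 set \<Rightarrow> 'a poly3 set \<Rightarrow> nat" where
  "rk I V = PV.dim (proj I ` V)"

definition hilb :: "'a::field poly3 set \<Rightarrow> nat \<Rightarrow> nat" where
  "hilb I t = rk I (hspace t)"

lemma
  assumes "PV.subspace I"
  shows linear_proj: "Vector_Spaces.linear scal scal (proj I)"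
    and proj_eq_0_iff: "proj I x = 0 \<longleftrightarrow> x \<in> I"
  using someI_ex[OF PV.exists_linear_with_kernel[OF assms]] unfolding proj_def by auto

lemma proj_eq_iff:
  assumes "PV.subspace I"
  shows "proj I x = proj I y \<longleftrightarrow> x - y \<in> I"
proof -
  interpret Vector_Spaces.linear scal scal "proj I" by (rule linear_proj[OF assms])
  show ?thesis using proj_eq_0_iff[OF assms, of "x - y"] by (simp add: diff)
qed

lemma rk_nullity:
  assumes "PV.subspace I" "PV.subspace V" "V \<subseteq> PV.span F" "finite F"
  shows "rk I V + PV.dim (V \<inter> I) = PV.dim V"
  using PP.rank_nullity[OF linear_proj[OF assms(1)] assms(2-4)]
  by (simp add: rk_def proj_eq_0_iff[OF assms(1)] Int_def)

lemma hspace_finite_span: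
  obtains F :: "'a::field poly3 set" where "finite F" "hspace t \<subseteq> PV.span F"
  by (rule that[of "monom ` mons t"]) (simp_all add: hspace_eq_span)

lemma proj_image_finite_span:
  assumes "PV.subspace I" "V \<subseteq> PV.span F" "finite F"
  obtains F' where "proj I ` V \<subseteq> PV.span F'" "finite F'"
proof
  show "proj I ` V \<subseteq> PV.span (proj I ` F)"
    using assms PP.linear_span_image[OF linear_proj[OF assms(1)], of F] by auto
qed (use assms in auto)

lemma rk_mono:
  assumes "PV.subspace I" "U \<subseteq> V" "V \<subseteq> hspace t"
  shows "rk I U \<le> rk I V"
proof -
  obtain F :: "'a poly3 set" where F: "finite F" "hspace t \<subseteq> PV.span F" by (rule hspace_finite_span)
  obtain F' where "proj I ` hspace t \<subseteq> PV.span F'" "finite F'"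
    by (rule proj_image_finite_span[OF assms(1) F(2,1)])
  then show ?thesis unfolding rk_def
    by (intro PV.dim_mono_finite[of _ _ F']) (use assms in auto)
qed

lemma linear_proj_mult:
  assumes "PV.subspace I"
  shows "Vector_Spaces.linear scal scal (\<lambda>p. proj I (q * p))"
proof -
  interpret Vector_Spaces.linear scal scal "proj I" by (rule linear_proj[OF assms])
  show ?thesis
    by (simp add: Vector_Spaces.linear_iff PV.vector_space_axioms distrib_left add scal_mult_right scale)
qed

lemma dim_zero: "PV.dim {0 :: 'a::field poly3} = 0"
  using PV.dim_le_card[of "{0}" "{}"] by simp

lemma hilb_plus_dim:
  assumes "PV.subspace I"
  shows "hilb I t + PV.dim (hspace t \<inter> I) = card (mons t)"
proof -
  obtain F :: "'a poly3 set" where "finite F" "hspace t \<subseteq> PV.span F" by (rule hspace_finite_span)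
  then show ?thesis
    using rk_nullity[OF assms hspace_subspace, of t F] by (simp add: dim_hspace hilb_def)
qed

text \<open>Additivity of dimensions along 0 -> (S/I)(-d) -> S/I -> S/J -> 0, where the first map is
  multiplication by \<open>f\<close> and J is the larger ideal. The space J_e / I_e is the image of
  degree e - d under this map, and regularity says that the kernel is I. For d > e the source is
  zero, which truncated subtraction would not show.\<close>

lemma hilb_insert:
  fixes f :: "'a::field poly3"
  assumes gr: "graded_ideal (ideal_gen G)" and hom: "homogeneous d f"
    and reg: "\<forall>g. g * f \<in> ideal_gen G \<longrightarrow> g \<in> ideal_gen G"
  shows "hilb (ideal_gen (insert f G)) e + (if d \<le> e then hilb (ideal_gen G) (e - d) else 0) = hilb (ideal_gen G) e"
proof -
  let ?I = "ideal_gen G" and ?J = "ideal_gen (insert f G)"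
  let ?V = "hspace e \<inter> ?J"
  have sI: "PV.subspace ?I" "PV.subspace ?J" by (simp_all add: is_ideal_subspace is_ideal_ideal_gen)
  have IJ: "?I \<subseteq> ?J" by (rule ideal_gen_minimal) (auto simp: is_ideal_ideal_gen in_ideal_gen)
  obtain F :: "'a poly3 set" where F: "finite F" "hspace e \<subseteq> PV.span F" by (rule hspace_finite_span)
  have sV: "PV.subspace ?V" using sI(2) by (intro PV.subspace_inter) auto
  have "?V \<inter> ?I = hspace e \<inter> ?I" using IJ by auto
  then have 1: "rk ?I ?V + PV.dim (hspace e \<inter> ?I) = PV.dim ?V"
    using rk_nullity[OF sI(1) sV, of F] F by auto
  interpret Vector_Spaces.linear scal scal "proj ?I" by (rule linear_proj[OF sI(1)])
  \<comment> \<open>The cofactor \<open>g\<close> of an element of J_e may have components of any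
    degree. In degree e only its component of degree e - d contributes, up to a component of
    \<open>q\<close>, which lies in the graded ideal I.\<close>
  have 2: "proj ?I p = proj ?I (f * (if d \<le> e then hcomp (e - d) g else 0))"
    if "p \<in> hspace e" "p = q + g * f" "q \<in> ?I" for p q g
  proof -
    have "p = hcomp e p" using that(1) by (simp add: hspace_def hcomp_homogeneous)
    also have "\<dots> = hcomp e q + f * (if d \<le> e then hcomp (e - d) g else 0)"
      unfolding that(2) hcomp_add hcomp_mult_homogeneous[OF hom] by (simp add: mult.commute)
    finally have "p - f * (if d \<le> e then hcomp (e - d) g else 0) = hcomp e q" by simp
    then show ?thesis
      using gr that(3) by (simp add: proj_eq_iff[OF sI(1)] graded_ideal_def)
  qed
  have 3: "rk ?I ?V = (if d \<le> e then hilb ?I (e - d) else 0)"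
  proof (cases "d \<le> e")
    case True
    let ?m = "\<lambda>p. proj ?I (f * p)"
    have "proj ?I ` ?V = ?m ` hspace (e - d)"
    proof (intro subset_antisym subsetI)
      fix y assume "y \<in> proj ?I ` ?V"
      then obtain p where p: "p \<in> hspace e" "p \<in> ?J" "y = proj ?I p" by blast
      then obtain q g where qg: "p = q + g * f" "q \<in> ?I" unfolding ideal_gen_insert by blast
      have "y = ?m (hcomp (e - d) g)" using 2[OF p(1) qg] p(3) True by simp
      then show "y \<in> ?m ` hspace (e - d)" by (auto simp: hspace_def)
    next
      fix y assume "y \<in> ?m ` hspace (e - d)"
      then obtain g where g: "homogeneous (e - d) g" "y = ?m g" by (auto simp: hspace_def)
      have "homogeneous e (f * g)" using homogeneous_mult[OF hom g(1)] True by simp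
      moreover have "f * g \<in> ?J"
        using is_idealD(3)[OF is_ideal_ideal_gen in_ideal_gen, of f "insert f G" g] by (simp add: mult.commute)
      ultimately show "y \<in> proj ?I ` ?V" using g(2) by (auto simp: hspace_def)
    qed
    moreover obtain F' :: "'a poly3 set" where F': "finite F'" "hspace (e - d) \<subseteq> PV.span F'"
      by (rule hspace_finite_span)
    moreover have "{x \<in> hspace (e - d). ?m x = 0} = hspace (e - d) \<inter> ?I"
      using reg is_idealD(3)[OF is_ideal_ideal_gen, of _ G f]
      by (auto simp: proj_eq_0_iff[OF sI(1)] mult.commute)
    ultimately have "rk ?I ?V + PV.dim (hspace (e - d) \<inter> ?I) = card (mons (e - d))"
      using PP.rank_nullity[OF linear_proj_mult[OF sI(1)], of "hspace (e - d)" F' f]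
      by (simp add: rk_def dim_hspace)
    then show ?thesis using hilb_plus_dim[OF sI(1), of "e - d"] True by simp
  next
    case False
    have "0 \<in> ?V" using PV.subspace_0[OF sV] .
    have "proj ?I ` ?V = {0}"
    proof (intro subset_antisym subsetI)
      fix y assume "y \<in> proj ?I ` ?V"
      then obtain p where p: "p \<in> hspace e" "p \<in> ?J" "y = proj ?I p" by blast
      then obtain q g where qg: "p = q + g * f" "q \<in> ?I" unfolding ideal_gen_insert by blast
      show "y \<in> {0}" using 2[OF p(1) qg] p(3) False zero by simp
    next
      fix y assume "y \<in> {0 :: 'a poly3}"
      then show "y \<in> proj ?I ` ?V" using \<open>0 \<in> ?V\<close> zero by (metis image_eqI singletonD)
    qed
    then show ?thesis using False by (simp add: rk_def dim_zero)
  qed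
  show ?thesis using 1 3 hilb_plus_dim[OF sI(1), of e] hilb_plus_dim[OF sI(2), of e] by simp
qed

lemma hilb_ideal_gen_empty: "hilb (ideal_gen {}) t = card (mons t)"
proof -
  have "hspace t \<inter> ideal_gen {} = {0 :: 'a poly3}" by (auto simp: hspace_def)
  then show ?thesis
    using hilb_plus_dim[of "ideal_gen {} :: 'a poly3 set" t]
    by (simp add: dim_zero is_ideal_subspace is_ideal_ideal_gen del: ideal_gen_empty)
qed

lemma graded_ideal3:
  assumes "homogeneous d1 f1" "homogeneous d2 f2" "homogeneous d3 f3"
  shows "graded_ideal (ideal_gen {f1,f2,f3})"
proof -
  have e: "{f1,f2,f3} = insert f3 (insert f2 (insert f1 {}))" by auto
  show ?thesis unfolding e by (intro graded_ideal_insert[OF _ assms(3)] graded_ideal_insert[OF _ assms(2)]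
    graded_ideal_insert[OF _ assms(1)] graded_ideal_empty)
qed

text \<open>The coefficient of z^e in (1 - z^d1) (1 - z^d2) (1 - z^d3) / (1 - z)^3, one factor at a
  time. The values are integers so that no difference is truncated.\<close>

definition ci_hilb :: "nat \<Rightarrow> nat \<Rightarrow> nat \<Rightarrow> nat \<Rightarrow> int" where
  "ci_hilb d1 d2 d3 e =
    (let h0 = \<lambda>e. int (card (mons e));
         h1 = \<lambda>e. h0 e - (if d1 \<le> e then h0 (e - d1) else 0);
         h2 = \<lambda>e. h1 e - (if d2 \<le> e then h1 (e - d2) else 0)
     in h2 e - (if d3 \<le> e then h2 (e - d3) else 0))"

lemma hilb_complete_intersection:
  assumes "regular_seq3 f1 f2 f3" "homogeneous d1 f1" "homogeneous d2 f2" "homogeneous d3 (f3 :: 'a::field poly3)"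
  shows "int (hilb (ideal_gen {f1,f2,f3}) e) = ci_hilb d1 d2 d3 e"
proof -
  have e: "{f1,f2,f3} = insert f3 {f1,f2}" "{f1,f2} = insert f2 {f1}" by auto
  have g0: "graded_ideal (ideal_gen {} :: 'a poly3 set)" by (rule graded_ideal_empty)
  have g1: "graded_ideal (ideal_gen {f1})" by (rule graded_ideal_insert[OF g0 assms(2)])
  have g2: "graded_ideal (ideal_gen {f1,f2})" unfolding e by (rule graded_ideal_insert[OF g1 assms(3)])
  have i: "int (hilb (ideal_gen (insert f G)) e) = int (hilb (ideal_gen G) e) - (if d \<le> e then int (hilb (ideal_gen G) (e - d)) else 0)"
    if "graded_ideal (ideal_gen G)" "homogeneous d f" "\<forall>g. g * f \<in> ideal_gen G \<longrightarrow> g \<in> ideal_gen G"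
    for f :: "'a poly3" and G d e
    using hilb_insert[OF that, of e] by auto
  have 1: "int (hilb (ideal_gen {f1}) e) = int (card (mons e)) - (if d1 \<le> e then int (card (mons (e - d1))) else 0)" for e
    using i[OF g0 assms(2)] assms(1) by (simp add: regular_seq3_def hilb_ideal_gen_empty del: ideal_gen_empty)
  have 2: "int (hilb (ideal_gen {f1,f2}) e) = int (hilb (ideal_gen {f1}) e) - (if d2 \<le> e then int (hilb (ideal_gen {f1}) (e - d2)) else 0)" for e
    using i[OF g1 assms(3)] assms(1) e by (simp add: regular_seq3_def)
  have 3: "int (hilb (ideal_gen {f1,f2,f3}) e) = int (hilb (ideal_gen {f1,f2}) e) - (if d3 \<le> e then int (hilb (ideal_gen {f1,f2}) (e - d3)) else 0)" for e
    using i[OF g2 assms(4)] assms(1) e by (simp add: regular_seq3_def)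
  show ?thesis unfolding 3 2 1 ci_hilb_def Let_def by simp
qed

text \<open>A third difference of the quadratic polynomial \<open>(e + 1) (e + 2) / 2\<close>.\<close>
lemma ci_hilb_eq_0:
  assumes "d1 + d2 + d3 \<le> e"
  shows "ci_hilb d1 d2 d3 e = 0"
proof -
  obtain x where x: "e = x + d1 + d2 + d3" using assms by (metis add.assoc add.commute le_Suc_ex)
  have c: "2 * int (card (mons t)) = (int t + 1) * (int t + 2)" for t
    using arg_cong[OF card_mons[of t], of int] by (simp add: algebra_simps)
  have "2 * ci_hilb d1 d2 d3 e =
      2 * int (card (mons (x+d1+d2+d3))) - 2 * int (card (mons (x+d2+d3))) - 2 * int (card (mons (x+d1+d3)))
      + 2 * int (card (mons (x+d3))) - 2 * int (card (mons (x+d1+d2))) + 2 * int (card (mons (x+d2)))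
      + 2 * int (card (mons (x+d1))) - 2 * int (card (mons x))"
    by (simp add: ci_hilb_def x Let_def algebra_simps)
  also have "\<dots> = 0" unfolding c by (simp add: algebra_simps)
  finally show ?thesis by simp
qed

subsection \<open>The strong Lefschetz property\<close>

definition mimg :: "'a::field poly3 \<Rightarrow> nat \<Rightarrow> nat \<Rightarrow> 'a poly3 set" where
  "mimg l k t = (\<lambda>p. l ^ k * p) ` hspace t"

text \<open>A linear map is injective or surjective exactly when its rank is the smaller of the two
  dimensions. The case \<open>k = 0\<close> is included because the layers below start with
  it.\<close>

definition lefschetz_element :: "'a::field poly3 set \<Rightarrow> 'a poly3 \<Rightarrow> bool" where
  "lefschetz_element I l \<longleftrightarrow> homogeneous 1 l \<and>
     (\<forall>k t. rk I (mimg l k t) = min (hilb I t) (hilb I (t + k)))"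

lemma mimg_subset_hspace: "homogeneous 1 l \<Longrightarrow> mimg l k t \<subseteq> hspace (t + k)"
  using homogeneous_mult[OF homogeneous_power[of 1 l k], of t]
  by (auto simp: mimg_def hspace_def add.commute[of t])

lemma mimg_Suc_subset: "homogeneous 1 l \<Longrightarrow> mimg l (Suc k) t \<subseteq> mimg l k (Suc t)"
  using homogeneous_mult[of 1 l t] by (auto simp: mimg_def hspace_def mult.assoc power_Suc2 simp del: power_Suc)

text \<open>The upper bound holds for every linear form. It is later applied to the last coordinate
  of coordinate systems in which that form is not known to be a Lefschetz element.\<close>

lemma rk_mimg_le:
  assumes "is_ideal I" "homogeneous 1 l"
  shows "rk I (mimg l k t) \<le> min (hilb I t) (hilb I (t + k))"
    and "mult_inj I l k t \<Longrightarrow> rk I (mimg l k t) = hilb I t"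
    and "mult_surj I l k t \<Longrightarrow> rk I (mimg l k t) = hilb I (t + k)"
proof -
  have sI: "PV.subspace I" by (rule is_ideal_subspace[OF assms(1)])
  obtain F :: "'a poly3 set" where F: "finite F" "hspace t \<subseteq> PV.span F" by (rule hspace_finite_span)
  let ?K = "{x \<in> hspace t. l ^ k * x \<in> I}"
  have r: "rk I (mimg l k t) + PV.dim ?K = card (mons t)"
    using PP.rank_nullity[OF linear_proj_mult[OF sI], of "hspace t" F "l ^ k"] F
    by (simp add: rk_def mimg_def image_image dim_hspace proj_eq_0_iff[OF sI])
  have "hspace t \<inter> I \<subseteq> ?K" using is_idealD(3)[OF assms(1)] by auto
  then have "PV.dim (hspace t \<inter> I) \<le> PV.dim ?K"
    by (rule PV.dim_mono_finite[where F = F]) (use F in auto)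
  then have "rk I (mimg l k t) \<le> hilb I t" using r hilb_plus_dim[OF sI, of t] by simp
  moreover have le2: "rk I (mimg l k t) \<le> hilb I (t + k)"
    unfolding hilb_def by (rule rk_mono[OF sI mimg_subset_hspace[OF assms(2)] order_refl])
  ultimately show "rk I (mimg l k t) \<le> min (hilb I t) (hilb I (t + k))" by simp
  show "rk I (mimg l k t) = hilb I t" if "mult_inj I l k t"
  proof -
    have "?K = hspace t \<inter> I" using that is_idealD(3)[OF assms(1)] by (auto simp: mult_inj_def hspace_def)
    then show ?thesis using r hilb_plus_dim[OF sI, of t] by simp
  qed
  show "rk I (mimg l k t) = hilb I (t + k)" if surj: "mult_surj I l k t"
  proof -
    have "proj I ` hspace (t + k) \<subseteq> proj I ` mimg l k t"
    proof
      fix y assume "y \<in> proj I ` hspace (t + k)"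
      then obtain h where h: "homogeneous (t + k) h" "y = proj I h" by (auto simp: hspace_def)
      then obtain g where g: "homogeneous t g" "h - l ^ k * g \<in> I" using surj by (auto simp: mult_surj_def)
      then have "y = proj I (l ^ k * g)" using h by (simp add: proj_eq_iff[OF sI])
      then show "y \<in> proj I ` mimg l k t" using g by (auto simp: mimg_def hspace_def)
    qed
    then have "proj I ` hspace (t + k) = proj I ` mimg l k t"
      using mimg_subset_hspace[OF assms(2)] by blast
    then show ?thesis by (simp add: hilb_def rk_def)
  qed
qed

lemma lefschetz_elementI:
  assumes "is_ideal I" "homogeneous 1 l" "\<And>k t. k \<ge> 1 \<Longrightarrow> mult_inj I l k t \<or> mult_surj I l k t"
  shows "lefschetz_element I l"
  unfolding lefschetz_element_def
proof (intro conjI allI)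
  fix k t
  have "mult_inj I l 0 t" by (simp add: mult_inj_def)
  then have "mult_inj I l k t \<or> mult_surj I l k t" using assms(3)[of k t] by (cases k) auto
  then show "rk I (mimg l k t) = min (hilb I t) (hilb I (t + k))"
    using rk_mimg_le[OF assms(1,2), of k t] by auto
qed (rule assms(2))

text \<open>\<open>strong_lefschetz\<close> admits the zero form, which cannot be completed to a
  coordinate system.\<close>

lemma strong_lefschetz_nonzero_element:
  assumes "is_ideal I" "1 \<notin> I" "strong_lefschetz I"
  shows "\<exists>l. lefschetz_element I l \<and> l \<noteq> 0"
proof -
  obtain l where l: "homogeneous 1 l" "\<And>b t. b \<ge> 1 \<Longrightarrow> mult_inj I l b t \<or> mult_surj I l b t"
    using assms(3) by (auto simp: strong_lefschetz_def)
  show ?thesis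
  proof (cases "l = 0")
    case False
    then show ?thesis using lefschetz_elementI[OF assms(1) l] by blast
  next
    case True
    \<comment> \<open>\<open>l = 0\<close> forces the quotient to be concentrated in degree 0, where any form will do.\<close>
    have z: "h \<in> I" if "homogeneous b h" "b \<ge> 1" for b h
    proof -
      have "\<not> mult_inj I l b 0"
        using assms(2) that(2) True is_idealD(1)[OF assms(1)]
        by (auto simp: mult_inj_def power_0_left intro!: exI[of _ 1])
      then have "mult_surj I l b 0" using l(2)[OF that(2)] by blast
      then show ?thesis using that True by (auto simp: mult_surj_def power_0_left)
    qed
    have "lefschetz_element I (monom (1,0,0))"
    proof (rule lefschetz_elementI[OF assms(1)])
      fix k t :: nat assume "k \<ge> 1"
      then show "mult_inj I (monom (1,0,0)) k t \<or> mult_surj I (monom (1,0,0)) k t"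
        using z[of "t + k"] by (auto simp: mult_surj_def intro!: exI[of _ 0])
    qed simp
    moreover have "monom (1,0,0) \<noteq> (0 :: 'a poly3)"
      by (metis monom_def lookup_single_eq lookup_zero one_neq_zero)
    ultimately show ?thesis by blast
  qed
qed

text \<open>The multiplication from degree t to degree e factors through degree x, so its rank is at
  most \<open>hilb I x\<close>; by the Lefschetz property this rank is the minimum on the
  left.\<close>

lemma lefschetz_unimodal:
  assumes "is_ideal I" "lefschetz_element I l" "t \<le> x" "x \<le> e"
  shows "min (hilb I t) (hilb I e) \<le> hilb I x"
proof -
  have sI: "PV.subspace I" by (rule is_ideal_subspace[OF assms(1)])
  have l: "homogeneous 1 l" "rk I (mimg l k t) = min (hilb I t) (hilb I (t + k))" for k t
    using assms(2) by (auto simp: lefschetz_element_def)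
  have "mimg l (e - t) t \<subseteq> mimg l (e - x) x"
  proof
    fix y assume "y \<in> mimg l (e - t) t"
    then obtain p where p: "homogeneous t p" "y = l ^ (e - t) * p" by (auto simp: mimg_def hspace_def)
    have "e - t = (e - x) + (x - t)" using assms by simp
    then have "y = l ^ (e - x) * (l ^ (x - t) * p)" by (simp only: p power_add mult.assoc)
    moreover have "homogeneous x (l ^ (x - t) * p)"
      using homogeneous_mult[OF homogeneous_power[OF l(1), of "x - t"] p(1)] assms(3) by simp
    ultimately show "y \<in> mimg l (e - x) x" by (auto simp: mimg_def hspace_def)
  qed
  moreover have "mimg l (e - x) x \<subseteq> hspace e" using mimg_subset_hspace[OF l(1), of "e - x" x] assms by simp
  ultimately have "rk I (mimg l (e - t) t) \<le> rk I (mimg l (e - x) x)" by (rule rk_mono[OF sI])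
  then show ?thesis using assms by (simp add: l(2))
qed

subsection \<open>The Wronskian argument\<close>

interpretation PU: vector_space "smult :: 'a::field \<Rightarrow> 'a poly \<Rightarrow> 'a poly"
  by unfold_locales (auto simp: smult_add_right smult_add_left)

interpretation UP: vector_space_pair "smult :: 'a::field \<Rightarrow> 'a poly \<Rightarrow> 'a poly" scal
  by unfold_locales

lemma power_dvd_pderiv:
  assumes "[:-s, 1:] ^ Suc r dvd (f :: 'a::field_char_0 poly)"
  shows "[:-s, 1:] ^ r dvd pderiv f"
proof -
  obtain g where f: "f = [:-s, 1:] ^ Suc r * g" using assms by (elim dvdE)
  have "pderiv f = [:-s, 1:] ^ r * ([:-s, 1:] * pderiv g + smult (of_nat (Suc r)) (pderiv [:-s, 1:]) * g)"
    unfolding f pderiv_mult pderiv_power_Suc by (simp add: algebra_simps)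
  then show ?thesis by (metis dvd_triv_left)
qed

text \<open>In characteristic 0 the order of a nonzero \<open>f\<close> at its root s drops by
  exactly one under differentiation. Multiplying by \<open>p\<close> keeps that order, as p does not
  vanish at s, whereas \<open>f * pderiv p\<close> has at least the order of
  \<open>f\<close>.\<close>

lemma eq_0_if_wronskian_eq_0:
  assumes "pderiv f * p = f * pderiv p" "poly f s = 0" "poly p s \<noteq> (0 :: 'a::field_char_0)"
  shows "f = 0"
proof (rule ccontr)
  assume f: "f \<noteq> 0"
  have p: "p \<noteq> 0" "order s p = 0" using assms(3) order_root by auto
  have "pderiv f \<noteq> 0"
  proof
    assume "pderiv f = 0"
    then have "degree f = 0" by (simp add: pderiv_eq_0_iff)
    then obtain a where "f = [:a:]" by (meson degree_eq_zeroE)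
    then show False using f assms(2) by simp
  qed
  then have "order s (pderiv f * p) = order s (pderiv f)" using p by (simp add: order_mult)
  also have "\<dots> < order s f" using order_pderiv[OF f assms(2)] by simp
  also have "\<dots> \<le> order s (f * pderiv p)"
    using assms(1) \<open>pderiv f \<noteq> 0\<close> p f by (subst order_mult) auto
  finally show False using assms(1) by simp
qed

text \<open>Passing from a space spanned by \<open>p\<close> and \<open>r\<close> further polynomials to its image under
  \<open>f \<mapsto> f' p - f p'\<close> lowers both the dimension and the order of vanishing by one.\<close>
lemma generic_order_of_vanishing:
  fixes qs :: "'a::field_char_0 poly list"
  shows "\<exists>bad. finite bad \<and>
    (\<forall>s f. s \<notin> bad \<longrightarrow> f \<in> PU.span (set qs) \<longrightarrow> [:-s, 1:] ^ length qs dvd f \<longrightarrow> f = 0)"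
proof (induction "length qs" arbitrary: qs)
  case 0
  then show ?case by (intro exI[of _ "{}"]) auto
next
  case (Suc r)
  then obtain p rest where qs: "qs = p # rest" "length rest = r" by (metis length_Suc_conv)
  define T where "T f = pderiv f * p - f * pderiv p" for f
  have lT: "Vector_Spaces.linear smult smult T"
    by (simp add: Vector_Spaces.linear_iff PU.vector_space_axioms T_def pderiv_add pderiv_smult algebra_simps smult_diff_right)
  interpret T: Vector_Spaces.linear smult smult T by (rule lT)
  show ?case
  proof (cases "p = 0")
    case True
    have "\<exists>bad. finite bad \<and>
      (\<forall>s f. s \<notin> bad \<longrightarrow> f \<in> PU.span (set rest) \<longrightarrow> [:-s, 1:] ^ length rest dvd f \<longrightarrow> f = 0)"
      by (rule Suc(1)) (use qs in auto)
    then obtain bad where bad: "finite bad"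
      "\<And>s f. s \<notin> bad \<Longrightarrow> f \<in> PU.span (set rest) \<Longrightarrow> [:-s, 1:] ^ length rest dvd f \<Longrightarrow> f = 0" by blast
    have "f = 0" if "s \<notin> bad" "f \<in> PU.span (set qs)" "[:-s, 1:] ^ length qs dvd f" for s f
    proof (rule bad(2))
      show "f \<in> PU.span (set rest)" using that(2) by (simp add: qs True)
      show "[:-s, 1:] ^ length rest dvd f"
        using that(3) le_imp_power_dvd[of "length rest" "length qs" "[:-s,1:]"] dvd_trans qs by fastforce
    qed fact
    then show ?thesis using bad(1) by blast
  next
    case False
    have "\<exists>bad. finite bad \<and>
      (\<forall>s f. s \<notin> bad \<longrightarrow> f \<in> PU.span (set (map T rest)) \<longrightarrow> [:-s, 1:] ^ length (map T rest) dvd f \<longrightarrow> f = 0)"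
      by (rule Suc(1)) (use qs in auto)
    then obtain bad where bad: "finite bad"
      "\<And>s f. s \<notin> bad \<Longrightarrow> f \<in> PU.span (T ` set rest) \<Longrightarrow> [:-s, 1:] ^ r dvd f \<Longrightarrow> f = 0"
      using qs by auto
    \<comment> \<open>The zeros of \<open>p\<close> join the exceptional set: the comparison of
      orders that recovers \<open>f = 0\<close> from \<open>T f = 0\<close> needs p to be nonzero at
      s.\<close>
    have "f = 0" if s: "s \<notin> bad \<union> {x. poly p x = 0}" and f: "f \<in> PU.span (set qs)"
      and d: "[:-s, 1:] ^ Suc r dvd f" for s f
    proof -
      have "T p = 0" by (simp add: T_def)
      have "T f \<in> T ` PU.span (set qs)" using f by blast
      also have "\<dots> = PU.span (insert 0 (T ` set rest))" by (simp add: T.span_image[symmetric] qs \<open>T p = 0\<close>)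
      finally have "T f \<in> PU.span (T ` set rest)" by simp
      moreover have "[:-s, 1:] ^ r dvd T f"
        unfolding T_def using power_dvd_pderiv[OF d] power_le_dvd[OF d, of r]
        by (intro dvd_diff dvd_mult2) simp_all
      ultimately have "T f = 0" using bad(2) s by blast
      moreover have "poly f s = 0" using d by (metis dvd_trans dvd_triv_left poly_eq_0_iff_dvd power_Suc)
      ultimately show ?thesis using eq_0_if_wronskian_eq_0[of f p s] s by (simp add: T_def)
    qed
    then show ?thesis
      using bad(1) poly_roots_finite[OF False] qs by (intro exI[of _ "bad \<union> {x. poly p x = 0}"]) auto
  qed
qed

subsection \<open>The standard monomials\<close>

text \<open>If \<open>h\<close> is the Hilbert function of \<open>A\<close> and \<open>l\<close> a Lefschetz element, \<open>layer h t k\<close> is the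
  dimension of \<open>l^k A_t / l^(k+1) A_(t-1)\<close>; this forces the number of standard monomials
  \<open>x1^i x2^j x3^k\<close> with \<open>i + j = t\<close>.\<close>
definition layer :: "(nat \<Rightarrow> nat) \<Rightarrow> nat \<Rightarrow> nat \<Rightarrow> nat" where
  "layer h t k = min (h t) (h (t + k)) - (if t = 0 then 0 else min (h (t - 1)) (h (t + k)))"

definition stdset :: "(nat \<Rightarrow> nat) \<Rightarrow> mon3 set" where
  "stdset h = {(i,j,k). i < layer h (i + j) k}"

lemma in_stdset [simp]: "(i,j,k) \<in> stdset h \<longleftrightarrow> i < layer h (i + j) k"
  by (simp add: stdset_def)

lemma finite_stdset:
  assumes "\<And>e. D \<le> e \<Longrightarrow> h e = 0"
  shows "finite (stdset h)" and "a \<in> stdset h \<Longrightarrow> mdeg a < D"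
proof -
  have *: "mdeg a < D" if "a \<in> stdset h" for a
  proof (rule ccontr)
    obtain i j k where a: "a = (i,j,k)" by (cases a)
    assume "\<not> mdeg a < D"
    then have "layer h (i + j) k = 0" using assms[of "i+j+k"] a by (simp add: layer_def)
    then show False using that a by simp
  qed
  then show "a \<in> stdset h \<Longrightarrow> mdeg a < D" .
  have "stdset h \<subseteq> (\<Union>e<D. mons e)" using * by (auto simp: mons_def)
  then show "finite (stdset h)" by (rule finite_subset) auto
qed

definition unimodal :: "(nat \<Rightarrow> nat) \<Rightarrow> bool" where
  "unimodal h \<longleftrightarrow> (\<forall>t x e. t \<le> x \<longrightarrow> x \<le> e \<longrightarrow> min (h t) (h e) \<le> h x)"

text \<open>Split off the monomials with last exponent exactly k; the others form the slice for k +
  1 and t - 1 in the same total degree. The layers telescope: unimodality keeps the subtraction in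
  \<open>layer\<close> from truncating, and the bound \<open>L\<close> makes every i below the layer
  an exponent of an actual monomial.\<close>

lemma card_stdset_slice:
  assumes "unimodal h" and L: "\<And>t k. layer h t k \<le> Suc t"
  shows "card {a \<in> stdset h. mdeg a = t + k \<and> k \<le> snd (snd a)} = min (h t) (h (t + k))"
proof (induction t arbitrary: k)
  case 0
  have "{a \<in> stdset h. mdeg a = 0 + k \<and> k \<le> snd (snd a)} = (if layer h 0 k = 0 then {} else {(0,0,k)})"
    by auto
  moreover have "layer h 0 k \<le> 1" using L[of 0 k] by simp
  moreover have "layer h 0 k = min (h 0) (h k)" by (simp add: layer_def)
  ultimately show ?case by auto
next
  case (Suc t)
  let ?X = "{a \<in> stdset h. mdeg a = t + Suc k \<and> Suc k \<le> snd (snd a)}"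
  let ?L = "(\<lambda>i. (i, Suc t - i, k)) ` {..<layer h (Suc t) k}"
  have fin: "finite ?X" by (rule finite_subset[OF _ finite_mons[of "t + Suc k"]]) (auto simp: mons_def)
  have "{a \<in> stdset h. mdeg a = Suc t + k \<and> k \<le> snd (snd a)} = ?L \<union> ?X" (is "?A = _")
  proof (intro subset_antisym subsetI)
    fix a assume a: "a \<in> ?A"
    obtain i j c where ijc: "a = (i,j,c)" by (cases a)
    show "a \<in> ?L \<union> ?X"
    proof (cases "c = k")
      case True
      then have "i + j = Suc t" using a ijc by simp
      then have "a = (i, Suc t - i, k)" "i < layer h (Suc t) k" using a ijc True by auto
      then show ?thesis by blast
    qed (use a ijc in auto)
  next
    fix a assume "a \<in> ?L \<union> ?X"
    then show "a \<in> ?A"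
    proof
      assume "a \<in> ?L"
      then obtain i where i: "a = (i, Suc t - i, k)" "i < layer h (Suc t) k" by blast
      then have "i \<le> Suc t" using L[of "Suc t" k] by simp
      then show ?thesis using i by simp
    qed auto
  qed
  moreover have "card (?L \<union> ?X) = card ?L + card ?X"
    by (rule card_Un_disjoint) (use fin in auto)
  moreover have "card ?L = layer h (Suc t) k" by (subst card_image) (auto simp: inj_on_def)
  moreover have "card ?X = min (h t) (h (Suc t + k))" using Suc[of "Suc k"] by simp
  moreover have "min (h t) (h (Suc t + k)) \<le> h (Suc t)"
    using assms(1) unfolding unimodal_def by (meson le_add1 le_SucI order_refl)
  ultimately show ?case by (simp add: layer_def)
qed

text \<open>If v has the last exponent of u, its first exponent is at least that of u. Otherwise v
  has a smaller last exponent; since u is nonstandard and u / x3 standard, the layer at t shrinks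
  between c - 1 and c. This places the total degree e on the descending side of h, where the layer
  of v is empty.\<close>

lemma stdset_almost_revlex:
  assumes uni: "unimodal h" and u: "(i,j,c) \<notin> stdset h" and min: "c > 0 \<Longrightarrow> (i,j,c-1) \<in> stdset h"
    and v: "i' + j' + c' = i + j + c" "revlex_gt (i',j',c') (i,j,c)"
  shows "(i',j',c') \<notin> stdset h"
proof (cases "c' < c")
  case False
  then have "c' = c" "j' < j \<or> j' = j \<and> i' < i" using v by (auto simp: revlex_gt_def split: if_splits)
  then have "i' + j' = i + j" "i \<le> i'" using v(1) by auto
  then show ?thesis using u \<open>c' = c\<close> by simp
next
  case True
  define t where "t = i + j"
  define e where "e = t + c"
  have c: "c > 0" using True by simp
  have e1: "t + (c - 1) = e - 1" "e = i' + j' + c'" using c v(1) by (auto simp: e_def t_def)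
  have U: "min (h x) (h z) \<le> h y" if "x \<le> y" "y \<le> z" for x y z
    using uni that unfolding unimodal_def by blast
  have lt: "layer h t c < layer h t (c - 1)" using u min[OF c] by (simp add: t_def)
  have "h e < h t"
  proof (rule ccontr)
    assume "\<not> h e < h t"
    then have le: "h t \<le> h e" by simp
    have "min (h t) (h e) \<le> h (e - 1)" by (rule U) (use c in \<open>auto simp: e_def\<close>)
    then have le1: "h t \<le> h (e - 1)" using le by (simp add: min_absorb1)
    have eqs: "layer h t c = h t - (if t = 0 then 0 else min (h (t - 1)) (h e))"
      "layer h t (c - 1) = h t - (if t = 0 then 0 else min (h (t - 1)) (h (e - 1)))"
      using le le1 unfolding layer_def e1(1) e_def[symmetric] by (simp_all only: min_absorb1)
    have "t \<noteq> 0" using lt unfolding eqs by (metis less_irrefl)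
    define x y where "x = min (h (t - 1)) (h (e - 1))" and "y = min (h (t - 1)) (h e)"
    have "h t - y < h t - x" using lt unfolding eqs x_def y_def by (simp only: \<open>t \<noteq> 0\<close> if_False)
    \<comment> \<open>A strict inequality of truncated differences yields both facts. Since x < y,
      the minimum x is h (e - 1), which is at least h t.\<close>
    then have "x < y" "x < h t" by arith+
    moreover have "y \<le> h (t - 1)" unfolding y_def by simp
    ultimately show False using le1 unfolding x_def by (simp add: min_def split: if_splits)
  qed
  then have he: "h e \<le> h x" if "t \<le> x" "x \<le> e" for x using U[OF that] by simp
  \<comment> \<open>As c' < c, both i' + j' and its predecessor lie between t and e. There h is at
    least h e, so the two minima in the layer cancel.\<close>
  have "t \<le> i' + j' - 1" "i' + j' > 0" "i' + j' \<le> e" using True c e1 by (auto simp: e_def t_def)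
  then have "h e \<le> h (i' + j')" "h e \<le> h (i' + j' - 1)" using he by auto
  moreover have "i' + j' \<noteq> 0" using \<open>i' + j' > 0\<close> by simp
  ultimately have "layer h (i' + j') c' = 0"
    unfolding layer_def e1(2)[symmetric] by (simp only: min_absorb2 if_False diff_self_eq_0)
  then show ?thesis by simp
qed

subsection \<open>Independence of the standard monomials in suitable coordinates\<close>

lemma mimg_subspace: "PV.subspace (mimg l k t)"
  unfolding mimg_def
proof (rule PP.linear_subspace_image[OF _ hspace_subspace])
  show "Vector_Spaces.linear scal scal (\<lambda>p. l ^ k * p)"
    by (simp add: Vector_Spaces.linear_iff PV.vector_space_axioms distrib_left scal_mult_right)
qed

lemma subst3_adj3:
  assumes "homogeneous t p"
  shows "subst3 M (subst3 (adj3 M) p) = scal (det3 M ^ t) p"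
    and "subst3 (adj3 M) (subst3 M p) = scal (det3 M ^ t) p"
proof -
  have h: "det3 M ^ mdeg a * Poly_Mapping.lookup p a = Poly_Mapping.lookup (scal (det3 M ^ t) p) a" for a
    using assms unfolding homogeneous_iff lookup_scal by (cases "Poly_Mapping.lookup p a = 0") (simp, metis)
  show "subst3 M (subst3 (adj3 M) p) = scal (det3 M ^ t) p"
    unfolding subst3_subst3
    by (rule poly_mapping_eqI, subst lookup_subst3_scalar_matrix[OF mat_mul_adj3(1)]) (simp_all only: h)
  show "subst3 (adj3 M) (subst3 M p) = scal (det3 M ^ t) p"
    unfolding subst3_subst3
    by (rule poly_mapping_eqI, subst lookup_subst3_scalar_matrix[OF mat_mul_adj3(2)]) (simp_all only: h)
qed

lemma homogeneous_eq_subst3: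
  fixes M :: "nat \<Rightarrow> nat \<Rightarrow> 'a::field"
  assumes "det3 M \<noteq> 0" "homogeneous t p"
  obtains q where "homogeneous t q" "p = subst3 M q"
proof
  show "homogeneous t (scal (inverse (det3 M ^ t)) (subst3 (adj3 M) p))"
    by (intro homogeneous_scal homogeneous_subst3 assms(2))
  show "p = subst3 M (scal (inverse (det3 M ^ t)) (subst3 (adj3 M) p))"
    using assms by (simp add: subst3_scal subst3_adj3)
qed

lemma exists_matrix_with_column:
  assumes "homogeneous 1 l" "l \<noteq> (0 :: 'a::field poly3)"
  obtains M where "det3 M \<noteq> 0" "lin_form M 2 = l"
proof -
  define a b c where "a = Poly_Mapping.lookup l (1,0,0)" and "b = Poly_Mapping.lookup l (0,1,0)"
    and "c = Poly_Mapping.lookup l (0,0,1)"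
  have l: "l = scal a (monom (1,0,0)) + scal b (monom (0,1,0)) + scal c (monom (0,0,1))"
  proof (rule poly_mapping_eqI)
    fix m
    show "Poly_Mapping.lookup l m = Poly_Mapping.lookup (scal a (monom (1,0,0)) + scal b (monom (0,1,0)) + scal c (monom (0,0,1))) m"
    proof (cases "mdeg m = 1")
      case True
      obtain i j k where m: "m = (i,j,k)" by (cases m)
      then have "m = (1,0,0) \<or> m = (0,1,0) \<or> m = (0,0,1)" using True by auto
      then show ?thesis by (elim disjE) (simp_all add: a_def b_def c_def lookup_add monom_def lookup_single)
    next
      case False
      then have "Poly_Mapping.lookup l m = 0" using assms(1) unfolding homogeneous_iff by blast
      moreover have "m \<noteq> (1,0,0)" "m \<noteq> (0,1,0)" "m \<noteq> (0,0,1)" using False by auto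
      ultimately show ?thesis by (simp add: lookup_add monom_def lookup_single)
    qed
  qed
  \<comment> \<open>The first two columns are the unit vectors with indices u and v, the positions
    other than one at which \<open>l\<close> has a nonzero coefficient.\<close>
  let ?M = "\<lambda>u v i (j::nat). if j = 2 then (if i = 0 then a else if i = (1::nat) then b else c)
    else if j = 0 then (if i = u then 1 else 0) else (if i = v then 1 else 0)"
  have lf: "lin_form (?M u v) 2 = l" for u v unfolding lin_form_alt l by simp
  have "c \<noteq> 0 \<or> b \<noteq> 0 \<or> a \<noteq> 0" using assms(2) l by auto
  then show ?thesis
  proof (elim disjE)
    assume "c \<noteq> 0" then show ?thesis using that[OF _ lf[of 0 1]] by (simp add: det3_def)
  next
    assume "b \<noteq> 0" then show ?thesis using that[OF _ lf[of 0 2]] by (simp add: det3_def)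
  next
    assume "a \<noteq> 0" then show ?thesis using that[OF _ lf[of 1 2]] by (simp add: det3_def)
  qed
qed

text \<open>The form \<open>y1^t f(y2 / y1) l^k\<close>.\<close>
definition homog_form :: "'a::field poly3 \<Rightarrow> 'a poly3 \<Rightarrow> 'a poly3 \<Rightarrow> nat \<Rightarrow> nat \<Rightarrow> 'a poly \<Rightarrow> 'a poly3" where
  "homog_form y1 y2 l t k f = (\<Sum>j\<le>t. scal (coeff f j) (y1 ^ (t - j) * y2 ^ j * l ^ k))"

lemma linear_homog_form: "Vector_Spaces.linear smult scal (homog_form y1 y2 l t k)"
  by (simp add: Vector_Spaces.linear_iff PV.vector_space_axioms PU.vector_space_axioms homog_form_def
      scal_add_left sum.distrib PV.scale_sum_right)

lemma sum_le_extend: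
  fixes f :: "nat \<Rightarrow> 'b::comm_monoid_add"
  assumes "m \<le> t" "\<And>j. m < j \<Longrightarrow> j \<le> t \<Longrightarrow> f j = 0"
  shows "(\<Sum>j\<le>t. f j) = (\<Sum>j\<le>m. f j)"
  by (rule sum.mono_neutral_right) (use assms in auto)

text \<open>Homogenization turns powers of z + s into powers of the new coordinate y2 + s y1. Thus
  divisibility by powers of that coordinate becomes order of vanishing at -s.\<close>

lemma homog_form_linear_power:
  assumes "m \<le> t"
  shows "homog_form y1 y2 l t k ([:s, 1:] ^ m) = y1 ^ (t - m) * (y2 + scal s y1) ^ m * l ^ k"
proof -
  have sp: "scal s y1 ^ n = scal (s ^ n) (y1 ^ n)" for n
    by (induction n) (simp_all add: scal_mult_left scal_mult_right mult.commute)
  have "(y2 + scal s y1) ^ m = (\<Sum>j\<le>m. of_nat (m choose j) * y2 ^ j * scal s y1 ^ (m - j))"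
    by (rule binomial_ring)
  also have "\<dots> = (\<Sum>j\<le>m. scal (of_nat (m choose j) * s ^ (m - j)) (y2 ^ j * y1 ^ (m - j)))"
  proof (rule sum.cong)
    fix j
    have "(of_nat (m choose j) :: 'a poly3) = scal (of_nat (m choose j)) 1"
      by (simp add: scal_def)
    then show "of_nat (m choose j) * y2 ^ j * scal s y1 ^ (m - j)
        = scal (of_nat (m choose j) * s ^ (m - j)) (y2 ^ j * y1 ^ (m - j))"
      by (simp only: sp scal_mult_left scal_mult_right scal_scal mult_1_left mult.commute[of "s ^ _"])
  qed simp
  finally have pow: "(y2 + scal s y1) ^ m = (\<Sum>j\<le>m. scal (of_nat (m choose j) * s ^ (m - j)) (y2 ^ j * y1 ^ (m - j)))" .
  have "homog_form y1 y2 l t k ([:s, 1:] ^ m) = (\<Sum>j\<le>m. scal (coeff ([:s, 1:] ^ m) j) (y1 ^ (t - j) * y2 ^ j * l ^ k))"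
    unfolding homog_form_def
    by (rule sum_le_extend[OF assms]) (simp add: coeff_eq_0 degree_linear_power)
  also have "\<dots> = (\<Sum>j\<le>m. y1 ^ (t - m) * scal (of_nat (m choose j) * s ^ (m - j)) (y2 ^ j * y1 ^ (m - j)) * l ^ k)"
  proof (rule sum.cong)
    fix j assume "j \<in> {..m}"
    then have j: "j \<le> m" by simp
    have "y1 ^ (t - j) = y1 ^ (t - m) * y1 ^ (m - j)"
      using j assms by (simp add: power_add[symmetric])
    then show "scal (coeff ([:s, 1:] ^ m) j) (y1 ^ (t - j) * y2 ^ j * l ^ k)
        = y1 ^ (t - m) * scal (of_nat (m choose j) * s ^ (m - j)) (y2 ^ j * y1 ^ (m - j)) * l ^ k"
      by (simp add: coeff_linear_poly_power[OF j] scal_mult_left scal_mult_right mult_ac)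
  qed simp
  also have "\<dots> = y1 ^ (t - m) * (y2 + scal s y1) ^ m * l ^ k"
    unfolding pow by (simp add: sum_distrib_left sum_distrib_right)
  finally show ?thesis .
qed

text \<open>The forms in l^k S_t with one further factor l. At \<open>t = 0\<close> there are none
  but zero, while t - 1 would truncate to 0.\<close>

definition tailspace :: "'a::field poly3 \<Rightarrow> nat \<Rightarrow> nat \<Rightarrow> 'a poly3 set" where
  "tailspace l k t = (if t = 0 then {0} else mimg l (Suc k) (t - 1))"

lemma tailspace_subspace: "PV.subspace (tailspace l k t)"
  by (simp add: tailspace_def mimg_subspace PV.subspace_single_0)

lemma polys_le_finite_span:
  "{f :: 'a::field poly. degree f \<le> t} = PU.span ((\<lambda>j. [:0,1:] ^ j) ` {..t})"
  "PU.dim {f :: 'a::field poly. degree f \<le> t} = Suc t"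
  "PU.subspace {f :: 'a::field poly. degree f \<le> t}"
proof -
  have s: "PU.subspace {f :: 'a poly. degree f \<le> t}"
    unfolding PU.subspace_def by (auto intro: degree_add_le order.trans[OF degree_smult_le])
  then show "PU.subspace {f :: 'a poly. degree f \<le> t}" .
  have m: "smult c ([:0,1:] ^ j) = Polynomial.monom c j" for c :: 'a and j
    by (simp add: monom_altdef)
  show eq: "{f :: 'a poly. degree f \<le> t} = PU.span ((\<lambda>j. [:0,1:] ^ j) ` {..t})"
  proof (rule subset_antisym)
    show "PU.span ((\<lambda>j. [:0,1:] ^ j) ` {..t}) \<subseteq> {f :: 'a poly. degree f \<le> t}"
      by (rule PU.span_minimal[OF _ s]) (auto simp: degree_linear_power)
    show "{f :: 'a poly. degree f \<le> t} \<subseteq> PU.span ((\<lambda>j. [:0,1:] ^ j) ` {..t})"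
    proof (rule subsetI)
      fix f :: "'a poly" assume "f \<in> {f. degree f \<le> t}"
      then have "f = (\<Sum>j\<le>t. smult (coeff f j) ([:0,1:] ^ j))"
        unfolding m by (simp add: poly_as_sum_of_monoms')
      then show "f \<in> PU.span ((\<lambda>j. [:0,1:] ^ j) ` {..t})"
        using PU.span_image_finite_iff[of "{..t}"] by blast
    qed
  qed
  have z: "\<forall>j\<in>{..t}. c j = 0" if "(\<Sum>j\<le>t. smult (c j) ([:0,1:] ^ j)) = 0" for c :: "nat \<Rightarrow> 'a"
  proof
    fix j assume "j \<in> {..t}"
    moreover have "coeff (\<Sum>j\<le>t. smult (c j) ([:0,1:] ^ j)) j = 0" unfolding that by simp
    ultimately show "c j = 0" unfolding m by (simp add: coeff_sum)
  qed
  have "PU.dim {f :: 'a poly. degree f \<le> t} = card ((\<lambda>j. [:0,1:] ^ j :: 'a poly) ` {..t})"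
    unfolding eq
    by (rule PU.dim_span_eq_card_independent, rule PU.independent_family(2)) (use z in auto)
  also have "\<dots> = card {..t}"
    by (rule card_image, rule PU.independent_family(1)) (use z in auto)
  finally show "PU.dim {f :: 'a poly. degree f \<le> t} = Suc t" by simp
qed

lemma subset_sumset:
  fixes A B :: "'b::comm_monoid_add set"
  shows "0 \<in> B \<Longrightarrow> A \<subseteq> {x + y | x y. x \<in> A \<and> y \<in> B}"
    and "0 \<in> A \<Longrightarrow> B \<subseteq> {x + y | x y. x \<in> A \<and> y \<in> B}"
  by (safe, metis add.right_neutral, metis add.left_neutral)

text \<open>Both passages to a quotient happen at once, modulo the subspace \<open>I2\<close>.
  Combining three rank-nullity identities, the rank is that of l^k S_t modulo I minus that of its
  intersection with \<open>I2\<close>. Modulo I this intersection is the tail, so both terms are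
  Lefschetz ranks.\<close>

lemma rk_layer:
  assumes "is_ideal I" "lefschetz_element I l"
    and I2_def: "I2 = {x + y | x y. x \<in> I \<and> y \<in> tailspace l k t}"
  shows "rk I2 (mimg l k t) = layer (hilb I) t k"
proof -
  have sI: "PV.subspace I" by (rule is_ideal_subspace[OF assms(1)])
  have l: "homogeneous 1 l" "\<And>k t. rk I (mimg l k t) = min (hilb I t) (hilb I (t + k))"
    using assms(2) by (auto simp: lefschetz_element_def)
  let ?V = "mimg l k t" and ?W = "tailspace l k t"
  have sI2: "PV.subspace I2" unfolding I2_def by (intro PV.subspace_sums sI tailspace_subspace)
  have WV: "?W \<subseteq> ?V"
  proof (cases t)
    case 0
    then show ?thesis using PV.subspace_0[OF mimg_subspace] by (simp add: tailspace_def)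
  next
    case (Suc t')
    then show ?thesis using mimg_Suc_subset[OF l(1)] by (simp add: tailspace_def)
  qed
  have II2: "I \<subseteq> I2"
    unfolding I2_def by (rule subset_sumset(1)[OF PV.subspace_0[OF tailspace_subspace]])
  have WI2: "?W \<subseteq> I2"
    unfolding I2_def by (rule subset_sumset(2)[OF PV.subspace_0[OF sI]])
  obtain F :: "'a poly3 set" where F: "finite F" "hspace (t + k) \<subseteq> PV.span F" by (rule hspace_finite_span)
  have VF: "?V \<subseteq> PV.span F" using mimg_subset_hspace[OF l(1), of k t] F by blast
  have sVI2: "PV.subspace (?V \<inter> I2)" by (intro PV.subspace_inter mimg_subspace sI2)
  have 1: "rk I2 ?V + PV.dim (?V \<inter> I2) = PV.dim ?V"
    by (rule rk_nullity[OF sI2 mimg_subspace VF F(1)])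
  have 2: "rk I ?V + PV.dim (?V \<inter> I) = PV.dim ?V"
    by (rule rk_nullity[OF sI mimg_subspace VF F(1)])
  have "?V \<inter> I2 \<inter> I = ?V \<inter> I" using II2 by blast
  moreover have "rk I (?V \<inter> I2) + PV.dim (?V \<inter> I2 \<inter> I) = PV.dim (?V \<inter> I2)"
    by (rule rk_nullity[OF sI sVI2 _ F(1)]) (use VF in blast)
  ultimately have 3: "rk I (?V \<inter> I2) + PV.dim (?V \<inter> I) = PV.dim (?V \<inter> I2)" by simp
  have "proj I ` (?V \<inter> I2) = proj I ` ?W"
  proof (rule subset_antisym)
    show "proj I ` ?W \<subseteq> proj I ` (?V \<inter> I2)" using WV WI2 by blast
    show "proj I ` (?V \<inter> I2) \<subseteq> proj I ` ?W"
    proof (rule image_subsetI)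
      fix x assume "x \<in> ?V \<inter> I2"
      then obtain a w where aw: "x = a + w" "a \<in> I" "w \<in> ?W" unfolding I2_def by blast
      then have "proj I x = proj I w" by (simp add: proj_eq_iff[OF sI])
      then show "proj I x \<in> proj I ` ?W" using aw(3) by blast
    qed
  qed
  then have "rk I (?V \<inter> I2) = rk I ?W" by (simp add: rk_def)
  also have "\<dots> = (if t = 0 then 0 else min (hilb I (t - 1)) (hilb I (t + k)))"
  proof (cases "t = 0")
    case True
    have "proj I 0 = 0" using proj_eq_0_iff[OF sI] PV.subspace_0[OF sI] by blast
    then show ?thesis using True by (simp add: rk_def tailspace_def dim_zero)
  next
    case False
    then show ?thesis by (simp add: tailspace_def l(2))
  qed
  finally have r: "rk I (?V \<inter> I2) = (if t = 0 then 0 else min (hilb I (t - 1)) (hilb I (t + k)))" .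
  have "rk I2 ?V = rk I ?V - rk I (?V \<inter> I2)" using 1 2 3 by simp
  then show ?thesis unfolding layer_def r l(2) .
qed

text \<open>Let n be the layer. Polynomials of degree at most t map onto the layer, so the kernel
  has dimension t + 1 - n. A relation among the n chosen forms gives a kernel element divisible by
  (z + s)^(t + 1 - n), an order of vanishing that equals the dimension of the kernel. Off a finite
  set of s only 0 has this property.\<close>

lemma generic_layer_independent:
  fixes I :: "'a::field_char_0 poly3 set"
  assumes I: "is_ideal I" "lefschetz_element I (lin_form M 2)" and M: "det3 M \<noteq> 0"
    and I2_def: "I2 = {x + y | x y. x \<in> I \<and> y \<in> tailspace (lin_form M 2) k t}"
  shows "layer (hilb I) t k \<le> Suc t"
    and "\<exists>bad. finite bad \<and> (\<forall>s c. s \<notin> bad \<longrightarrow>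
      (\<Sum>i<layer (hilb I) t k. scal (c i) (lin_form M 0 ^ i * (lin_form M 1 + scal s (lin_form M 0)) ^ (t - i) * lin_form M 2 ^ k)) \<in> I2
      \<longrightarrow> (\<forall>i<layer (hilb I) t k. c i = 0))"
proof -
  define y1 y2 l where "y1 = lin_form M 0" and "y2 = lin_form M 1" and "l = lin_form M 2"
  note yl = y1_def[symmetric] y2_def[symmetric] l_def[symmetric]
  have I2: "I2 = {x + y | x y. x \<in> I \<and> y \<in> tailspace l k t}" by (simp add: I2_def l_def)
  let ?n = "layer (hilb I) t k"
  let ?P = "{f :: 'a poly. degree f \<le> t}"
  let ?\<Phi> = "homog_form y1 y2 l t k"
  have sI: "PV.subspace I" by (rule is_ideal_subspace[OF I(1)])
  have sI2: "PV.subspace I2" unfolding I2 by (intro PV.subspace_sums sI tailspace_subspace)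
  have WI2: "tailspace l k t \<subseteq> I2"
    unfolding I2 by (rule subset_sumset(2)[OF PV.subspace_0[OF sI]])
  have lPhi: "Vector_Spaces.linear smult scal ?\<Phi>" by (rule linear_homog_form)
  have sV: "PV.subspace {x + y | x y. x \<in> ?\<Phi> ` ?P \<and> y \<in> tailspace l k t}"
    by (intro PV.subspace_sums tailspace_subspace UP.linear_subspace_image[OF lPhi] polys_le_finite_span(3))
  \<comment> \<open>Modulo the tail every monomial containing l disappears, so binary forms in y1
    and y2 times l^k suffice.\<close>
  have cover: "x \<in> {x + y | x y. x \<in> ?\<Phi> ` ?P \<and> y \<in> tailspace l k t}" if "x \<in> mimg l k t" for x
  proof -
    obtain p where p: "homogeneous t p" "x = l ^ k * p" using \<open>x \<in> mimg l k t\<close> by (auto simp: mimg_def hspace_def)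
    obtain q where q: "homogeneous t q" "p = subst3 M q" by (rule homogeneous_eq_subst3[OF M p(1)])
    have "x = (\<Sum>a\<in>Poly_Mapping.keys q. scal (Poly_Mapping.lookup q a) (l ^ k * mon_subst M a))"
      unfolding p(2) q(2) subst3_alt[OF finite_keys order_refl]
      by (simp add: sum_distrib_left scal_mult_right)
    also have "\<dots> \<in> {x + y | x y. x \<in> ?\<Phi> ` ?P \<and> y \<in> tailspace l k t}"
    proof (intro PV.subspace_sum[OF sV] PV.subspace_scale[OF sV])
      fix a assume a: "a \<in> Poly_Mapping.keys q"
      obtain i j c where ijc: "a = (i,j,c)" by (cases a)
      have t: "i + j + c = t" using a q(1) ijc by (auto simp: homogeneous_def)
      show "l ^ k * mon_subst M a \<in> {x + y | x y. x \<in> ?\<Phi> ` ?P \<and> y \<in> tailspace l k t}"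
      proof (cases c)
        case 0
        have "l ^ k * mon_subst M a = ?\<Phi> ([:0,1:] ^ j) + 0"
          using homog_form_linear_power[of j t y1 y2 l k 0] t 0 ijc
          by (simp add: mon_subst_def yl yl(2)[unfolded One_nat_def] mult_ac flip: t)
        moreover have "[:0,1:] ^ j \<in> ?P" using t by (simp add: degree_linear_power)
        ultimately show ?thesis using PV.subspace_0[OF tailspace_subspace] by blast
      next
        case (Suc c')
        have "l ^ k * mon_subst M a = l ^ Suc k * mon_subst M (i,j,c')"
          by (simp add: mon_subst_def yl ijc Suc mult_ac)
        moreover have "mon_subst M (i,j,c') \<in> hspace (t - 1)"
          using homogeneous_mon_subst[of "(i,j,c')" M] t Suc by (auto simp: hspace_def simp flip: t)
        ultimately have "l ^ k * mon_subst M a \<in> tailspace l k t"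
          using t Suc by (auto simp: tailspace_def mimg_def)
        moreover have "0 \<in> ?\<Phi> ` ?P"
          using PV.subspace_0[OF UP.linear_subspace_image[OF lPhi polys_le_finite_span(3)]] .
        ultimately show ?thesis by (metis (mono_tags, lifting) add_0 mem_Collect_eq)
      qed
    qed
    finally show ?thesis .
  qed
  have PhiV: "?\<Phi> ` ?P \<subseteq> mimg l k t"
  proof (rule image_subsetI)
    fix f assume "f \<in> ?P"
    have "?\<Phi> f = l ^ k * (\<Sum>j\<le>t. scal (coeff f j) (y1 ^ (t - j) * y2 ^ j))"
      by (simp add: homog_form_def sum_distrib_left scal_mult_right mult_ac)
    moreover have "homogeneous t (\<Sum>j\<le>t. scal (coeff f j) (y1 ^ (t - j) * y2 ^ j))"
    proof (intro homogeneous_sum homogeneous_scal)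
      fix j assume "j \<in> {..t}"
      then show "homogeneous t (y1 ^ (t - j) * y2 ^ j)"
        using homogeneous_mult[OF homogeneous_power[OF homogeneous_lin_form[of M 0], of "t - j"]
            homogeneous_power[OF homogeneous_lin_form[of M 1], of j]] unfolding yl by simp
    qed
    ultimately show "?\<Phi> f \<in> mimg l k t" by (auto simp: mimg_def hspace_def)
  qed
  have "proj I2 ` mimg l k t = proj I2 ` ?\<Phi> ` ?P"
  proof (rule subset_antisym)
    show "proj I2 ` ?\<Phi> ` ?P \<subseteq> proj I2 ` mimg l k t" using PhiV by blast
    show "proj I2 ` mimg l k t \<subseteq> proj I2 ` ?\<Phi> ` ?P"
    proof (rule image_subsetI)
      fix x assume "x \<in> mimg l k t"
      then obtain a w where aw: "x = a + w" "a \<in> ?\<Phi> ` ?P" "w \<in> tailspace l k t" using cover by blast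
      have "proj I2 x = proj I2 a" using aw(1,3) WI2 by (auto simp: proj_eq_iff[OF sI2])
      then show "proj I2 x \<in> proj I2 ` ?\<Phi> ` ?P" using aw(2) by blast
    qed
  qed
  then have rkn: "PV.dim ((\<lambda>f. proj I2 (?\<Phi> f)) ` ?P) = ?n"
    using rk_layer[OF I(1) I(2)[folded l_def] I2] by (simp add: rk_def image_image)
  have lcomp: "Vector_Spaces.linear smult scal (\<lambda>f. proj I2 (?\<Phi> f))"
    using Vector_Spaces.linear_compose[OF lPhi linear_proj[OF sI2]] by (simp add: o_def)
  let ?N = "{f \<in> ?P. proj I2 (?\<Phi> f) = 0}"
  have dimN: "?n + PU.dim ?N = Suc t"
    using UP.rank_nullity[OF lcomp polys_le_finite_span(3), of t "(\<lambda>j. [:0,1:] ^ j) ` {..t}"]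
    by (simp add: rkn polys_le_finite_span(2)) (simp add: polys_le_finite_span(1))
  then show n: "?n \<le> Suc t" by simp
  obtain B where B: "B \<subseteq> ?N" "PU.independent B" "?N \<subseteq> PU.span B" "card B = PU.dim ?N"
    by (rule PU.basis_exists)
  have "?N \<subseteq> PU.span ((\<lambda>j. [:0,1:] ^ j) ` {..t})" using polys_le_finite_span(1)[of t] by blast
  then have "finite B" using PU.independent_span_bound[OF _ B(2)] B(1) by blast
  then obtain qs where qs: "set qs = B" "length qs = card B" using finite_distinct_list distinct_card by metis
  obtain bad where bad: "finite bad"
    "\<And>s f. s \<notin> bad \<Longrightarrow> f \<in> PU.span B \<Longrightarrow> [:-s, 1:] ^ length qs dvd f \<Longrightarrow> f = 0"
    using generic_order_of_vanishing[of qs] qs(1) by blast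
  \<comment> \<open>The factor z + s vanishes at -s, whence the negated exceptional set.\<close>
  have "c i = 0" if s: "s \<notin> uminus ` bad" and i: "i < ?n"
    and sum: "(\<Sum>i<?n. scal (c i) (y1 ^ i * (y2 + scal s y1) ^ (t - i) * l ^ k)) \<in> I2" for s c i
  proof -
    interpret Phi: Vector_Spaces.linear smult scal ?\<Phi> by (rule lPhi)
    let ?f = "\<Sum>i<?n. smult (c i) ([:s, 1:] ^ (t - i))"
    have "?\<Phi> ?f = (\<Sum>i<?n. scal (c i) (?\<Phi> ([:s, 1:] ^ (t - i))))"
      by (simp only: Phi.sum Phi.scale)
    also have "\<dots> = (\<Sum>i<?n. scal (c i) (y1 ^ i * (y2 + scal s y1) ^ (t - i) * l ^ k))"
    proof (rule sum.cong)
      fix i assume "i \<in> {..<?n}"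
      then have "t - (t - i) = i" using n by auto
      then show "scal (c i) (?\<Phi> ([:s, 1:] ^ (t - i))) = scal (c i) (y1 ^ i * (y2 + scal s y1) ^ (t - i) * l ^ k)"
        by (simp add: homog_form_linear_power)
    qed simp
    finally have "?\<Phi> ?f \<in> I2" using sum by simp
    moreover have "?f \<in> ?P"
      by (intro PU.subspace_sum[OF polys_le_finite_span(3)] PU.subspace_scale[OF polys_le_finite_span(3)])
        (simp add: degree_linear_power)
    ultimately have "?f \<in> PU.span B" using B(3) by (auto simp: proj_eq_0_iff[OF sI2])
    moreover have "- s \<notin> bad" using s by (metis image_eqI minus_minus)
    moreover have "[:-(-s), 1:] ^ length qs dvd ?f"
    proof (rule dvd_sum, rule dvd_smult)
      fix i assume "i \<in> {..<?n}"
      \<comment> \<open>For i < n the exponent t - i is at least t + 1 - n, which is the dimension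
        of the kernel.\<close>
      then have "length qs \<le> t - i" using qs(2) B(4) dimN by auto
      then show "[:-(-s), 1:] ^ length qs dvd [:s, 1:] ^ (t - i)" by (simp add: le_imp_power_dvd)
    qed
    ultimately have f0: "?f = 0" using bad(2) by blast
    let ?g = "\<Sum>i<?n. Polynomial.monom (c i) (t - i)"
    \<comment> \<open>Translation by s is injective, which reduces the independence of the powers of
      z + s to that of the powers of z.\<close>
    have "pcompose ?g [:s, 1:] = ?f"
      unfolding pcompose_sum
    proof (rule sum.cong)
      fix i
      have "[:s, 1:] ^ m = pcompose ([:0,1:] ^ m) [:s, 1:]" for m
        by (induction m) (simp_all only: power_0 power_Suc pcompose_mult pcompose_1, simp add: pcompose_pCons)
      then show "pcompose (Polynomial.monom (c i) (t - i)) [:s, 1:] = smult (c i) ([:s, 1:] ^ (t - i))"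
        by (simp add: monom_altdef pcompose_smult)
    qed simp
    then have "?g = 0" using f0 pcompose_eq_0[of ?g "[:s,1:]"] by simp
    then have "0 = coeff ?g (t - i)" by simp
    also have "\<dots> = (\<Sum>j<?n. if j = i then c j else 0)"
      unfolding coeff_sum
    proof (rule sum.cong)
      fix j assume "j \<in> {..<?n}"
      then have "t - j = t - i \<longleftrightarrow> j = i" using i n by auto
      then show "coeff (Polynomial.monom (c j) (t - j)) (t - i) = (if j = i then c j else 0)" by simp
    qed simp
    also have "\<dots> = c i" using i by simp
    finally show "c i = 0" by simp
  qed
  then show "\<exists>bad. finite bad \<and> (\<forall>s c. s \<notin> bad \<longrightarrow>
      (\<Sum>i<layer (hilb I) t k. scal (c i) (lin_form M 0 ^ i * (lin_form M 1 + scal s (lin_form M 0)) ^ (t - i) * lin_form M 2 ^ k)) \<in> I2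
      \<longrightarrow> (\<forall>i<layer (hilb I) t k. c i = 0))"
    unfolding yl using bad(1) by (intro exI[of _ "uminus ` bad"]) blast
qed

text \<open>\<open>N\<close> is the inverse of the coordinate change: instead of transforming
  \<open>I\<close>, the candidate relation is pulled back into it.\<close>

definition std_independent :: "'a::field poly3 set \<Rightarrow> (nat \<Rightarrow> nat \<Rightarrow> 'a) \<Rightarrow> bool" where
  "std_independent I N \<longleftrightarrow>
     (\<forall>p. Poly_Mapping.keys p \<subseteq> stdset (hilb I) \<longrightarrow> subst3 N p \<in> I \<longrightarrow> p = 0)"

lemma keys_hcomp: "Poly_Mapping.keys (hcomp e p) = {a \<in> Poly_Mapping.keys p. mdeg a = e}"
  using lookup_hcomp[of e p] by (simp add: set_eq_iff in_keys_iff when_def)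

text \<open>A homogeneous relation is examined at its lowest power of the last variable. Modulo the
  tail the other terms vanish, leaving a relation within a single layer, which is trivial for
  generic s.\<close>

lemma exists_std_independent:
  fixes I :: "'a::field_char_0 poly3 set"
  assumes gr: "graded_ideal I" and l: "lefschetz_element I l" "l \<noteq> 0"
    and D: "\<And>e. D \<le> e \<Longrightarrow> hilb I e = 0"
  shows "\<exists>N. det3 N \<noteq> 0 \<and> std_independent I N"
proof -
  have I: "is_ideal I" using gr by (simp add: graded_ideal_def)
  have sI: "PV.subspace I" by (rule is_ideal_subspace[OF I])
  have "homogeneous 1 l" using l(1) by (simp add: lefschetz_element_def)
  then obtain M where M: "det3 M \<noteq> 0" "lin_form M 2 = l" by (rule exists_matrix_with_column[OF _ l(2)])
  define I2 where "I2 t k = {x + y | x y. x \<in> I \<and> y \<in> tailspace l k t}" for t k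
  have sI2: "PV.subspace (I2 t k)" for t k
    unfolding I2_def by (intro PV.subspace_sums sI tailspace_subspace)
  have lI: "lefschetz_element I (lin_form M 2)" using l(1) M(2) by simp
  define Q where "Q t k s \<longleftrightarrow> (\<forall>c.
      (\<Sum>i<layer (hilb I) t k. scal (c i) (lin_form M 0 ^ i * (lin_form M 1 + scal s (lin_form M 0)) ^ (t - i) * l ^ k)) \<in> I2 t k
      \<longrightarrow> (\<forall>i<layer (hilb I) t k. c i = 0))" for t k s
  have "\<exists>bad. finite bad \<and> (\<forall>s. s \<notin> bad \<longrightarrow> Q t k s)" for t k
  proof -
    obtain bad where "finite bad" "\<forall>s c. s \<notin> bad \<longrightarrow>
      (\<Sum>i<layer (hilb I) t k. scal (c i) (lin_form M 0 ^ i * (lin_form M 1 + scal s (lin_form M 0)) ^ (t - i) * l ^ k)) \<in> I2 t k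
      \<longrightarrow> (\<forall>i<layer (hilb I) t k. c i = 0)"
      using generic_layer_independent(2)[OF I lI M(1) refl, where t = t and k = k] unfolding M(2) I2_def by (elim exE conjE)
    then show ?thesis unfolding Q_def by (intro exI[of _ bad]) simp
  qed
  then obtain bad where bad: "\<And>t k. finite (bad t k)" "\<And>t k s. s \<notin> bad t k \<Longrightarrow> Q t k s" by metis
  \<comment> \<open>Standard monomials have degree below D, so only layers with t and k below D
    occur.\<close>
  have "finite (\<Union>t<D. \<Union>k<D. bad t k)" using bad(1) by blast
  then obtain s where s: "s \<notin> (\<Union>t<D. \<Union>k<D. bad t k)"
    using ex_new_if_finite[OF infinite_UNIV_char_0] by blast
  \<comment> \<open>Adding s times the first column to the second keeps the determinant and the
    Lefschetz element in the last column.\<close>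
  define N where "N i j = M i j + (if j = (1::nat) then s * M i 0 else 0)" for i j
  have detN: "det3 N \<noteq> 0"
  proof -
    have "det3 N = det3 M" by (simp add: det3_def N_def algebra_simps)
    then show ?thesis using M(1) by simp
  qed
  have N: "lin_form N 0 = lin_form M 0" "lin_form N 1 = lin_form M 1 + scal s (lin_form M 0)" "lin_form N 2 = l"
    unfolding M(2)[symmetric] lin_form_alt N_def
    by (simp_all add: scal_add_left scal_add_right add_ac)
  have hom0: "p = 0" if p: "homogeneous e p" "Poly_Mapping.keys p \<subseteq> stdset (hilb I)" "subst3 N p \<in> I" for e p
  proof (rule ccontr)
    assume "p \<noteq> 0"
    define K where "K = (\<lambda>a. snd (snd a)) ` Poly_Mapping.keys p"
    have K: "finite K" "K \<noteq> {}" using \<open>p \<noteq> 0\<close> by (simp_all add: K_def)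
    define k where "k = Min K"
    have "k \<in> K" using K by (simp add: k_def)
    then obtain i0 j0 where a0: "(i0,j0,k) \<in> Poly_Mapping.keys p" unfolding K_def by auto
    define t where "t = i0 + j0"
    have e: "e = t + k" using a0 p(1) by (auto simp: homogeneous_def t_def)
    have kmin: "k \<le> snd (snd a)" if "a \<in> Poly_Mapping.keys p" for a
      using that K(1) by (auto simp: k_def K_def)
    have deg: "mdeg a = t + k" if "a \<in> Poly_Mapping.keys p" for a
      using that p(1) e by (simp add: homogeneous_def)
    let ?n = "layer (hilb I) t k"
    let ?L = "{a \<in> Poly_Mapping.keys p. snd (snd a) = k}"
    let ?R = "{a \<in> Poly_Mapping.keys p. snd (snd a) \<noteq> k}"
    have tD: "t < D" "k < D"
    proof -
      have "(i0,j0,k) \<in> stdset (hilb I)" using a0 p(2) by blast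
      then have "mdeg (i0,j0,k) < D" using finite_stdset(2)[of D "hilb I"] D by blast
      then show "t < D" "k < D" by (simp_all add: t_def)
    qed
    then have sb: "s \<notin> bad t k" using s by blast
    have LR: "Poly_Mapping.keys p = ?L \<union> ?R" by blast
    have "subst3 N p = (\<Sum>a\<in>?L \<union> ?R. scal (Poly_Mapping.lookup p a) (mon_subst N a))"
      by (subst subst3_alt[OF finite_keys order_refl]) (rule sum.cong[OF LR refl])
    also have "\<dots> = (\<Sum>a\<in>?L. scal (Poly_Mapping.lookup p a) (mon_subst N a))
        + (\<Sum>a\<in>?R. scal (Poly_Mapping.lookup p a) (mon_subst N a))"
      by (rule sum.union_disjoint) auto
    finally have split: "subst3 N p = (\<Sum>a\<in>?L. scal (Poly_Mapping.lookup p a) (mon_subst N a))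
        + (\<Sum>a\<in>?R. scal (Poly_Mapping.lookup p a) (mon_subst N a))" .
    have R: "(\<Sum>a\<in>?R. scal (Poly_Mapping.lookup p a) (mon_subst N a)) \<in> tailspace l k t"
    proof (intro PV.subspace_sum[OF tailspace_subspace] PV.subspace_scale[OF tailspace_subspace])
      fix a assume a: "a \<in> ?R"
      obtain i j c where ijc: "a = (i,j,c)" by (cases a)
      have c: "k < c" "i + j + c = t + k" using a kmin[of a] deg[of a] ijc by auto
      have "mon_subst N a = l ^ Suc k * mon_subst N (i,j,c - Suc k)"
        using c power_add[of l "Suc k" "c - Suc k"] by (simp add: mon_subst_def ijc N(3) mult_ac)
      moreover have "mon_subst N (i,j,c - Suc k) \<in> hspace (t - 1)"
        using homogeneous_mon_subst[of "(i,j,c - Suc k)" N] c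
        by (simp add: hspace_def)
      ultimately show "mon_subst N a \<in> tailspace l k t" using c by (auto simp: tailspace_def mimg_def)
    qed
    have L: "(\<Sum>a\<in>?L. scal (Poly_Mapping.lookup p a) (mon_subst N a))
        = (\<Sum>i<?n. scal (Poly_Mapping.lookup p (i, t - i, k)) (lin_form M 0 ^ i * (lin_form M 1 + scal s (lin_form M 0)) ^ (t - i) * l ^ k))"
    proof -
      have n: "?n \<le> Suc t" by (rule generic_layer_independent(1)[OF I lI M(1) refl])
      let ?A = "(\<lambda>i. (i, t - i, k)) ` {..<?n}"
      have "?L \<subseteq> ?A"
      proof
        fix a assume a: "a \<in> ?L"
        then obtain i j where ij: "a = (i,j,k)" by (cases a) auto
        have "i + j = t" using deg[of a] a ij by simp
        moreover have "i < layer (hilb I) (i + j) k" using a p(2) ij by auto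
        ultimately have "a = (i, t - i, k)" "i < ?n" using ij by auto
        then show "a \<in> ?A" by blast
      qed
      then have "(\<Sum>a\<in>?L. scal (Poly_Mapping.lookup p a) (mon_subst N a)) = (\<Sum>a\<in>?A. scal (Poly_Mapping.lookup p a) (mon_subst N a))"
        by (intro sum.mono_neutral_left) (auto simp: in_keys_iff)
      also have "\<dots> = (\<Sum>i<?n. scal (Poly_Mapping.lookup p (i, t - i, k)) (mon_subst N (i, t - i, k)))"
        by (subst sum.reindex) (auto simp: inj_on_def)
      finally show ?thesis by (simp add: mon_subst_def N N(2)[unfolded One_nat_def])
    qed
    have "subst3 N p \<in> I2 t k" "(\<Sum>a\<in>?R. scal (Poly_Mapping.lookup p a) (mon_subst N a)) \<in> I2 t k"
      using p(3) R subset_sumset[of "tailspace l k t" I] subset_sumset[of I "tailspace l k t"]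
        PV.subspace_0[OF sI] PV.subspace_0[OF tailspace_subspace, of l k t]
      unfolding I2_def by blast+
    then have "subst3 N p - (\<Sum>a\<in>?R. scal (Poly_Mapping.lookup p a) (mon_subst N a)) \<in> I2 t k"
      by (rule PV.subspace_diff[OF sI2])
    then have "(\<Sum>a\<in>?L. scal (Poly_Mapping.lookup p a) (mon_subst N a)) \<in> I2 t k"
      unfolding split by simp
    then have "Poly_Mapping.lookup p (i, t - i, k) = 0" if "i < ?n" for i
      using bad(2)[OF sb, unfolded Q_def, THEN spec, of "\<lambda>i. Poly_Mapping.lookup p (i, t - i, k)"] that
      unfolding L by simp
    moreover have "i0 < ?n" "t - i0 = j0" using a0 p(2) by (auto simp: t_def)
    ultimately show False using a0 by (simp add: in_keys_iff) metis
  qed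
  have "std_independent I N"
    unfolding std_independent_def
  proof (intro allI impI)
    fix p assume p: "Poly_Mapping.keys p \<subseteq> stdset (hilb I)" "subst3 N p \<in> I"
    have "hcomp e p = 0" for e
    proof (rule hom0)
      show "homogeneous e (hcomp e p)" by simp
      show "Poly_Mapping.keys (hcomp e p) \<subseteq> stdset (hilb I)" using p(1) keys_hcomp by blast
      show "subst3 N (hcomp e p) \<in> I"
        using p(2) gr unfolding hcomp_subst3[symmetric] by (simp add: graded_ideal_def)
    qed
    then have "Poly_Mapping.lookup p a = 0" for a
      using lookup_hcomp[of "mdeg a" p a] by simp
    then show "p = 0" by (intro poly_mapping_eqI) simp
  qed
  then show ?thesis using detN by blast
qed

subsection \<open>Initial ideals\<close>

lemma revlex_gt_irrefl: "\<not> revlex_gt a a"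
  by (simp add: revlex_gt_def)

lemma revlex_gt_trans: "revlex_gt a b \<Longrightarrow> revlex_gt b c \<Longrightarrow> revlex_gt a c"
  unfolding revlex_gt_def by (simp split: if_splits; linarith?)

lemma revlex_gt_total: "a \<noteq> b \<Longrightarrow> revlex_gt a b \<or> revlex_gt b a"
  by (cases a; cases b) (auto simp: revlex_gt_def split: if_splits)

lemma revlex_gt_add: "revlex_gt a b \<Longrightarrow> revlex_gt (w + a) (w + b)"
  by (cases a; cases b; cases w) (auto simp: revlex_gt_def split: if_splits)

lemma lead_mon_eqI:
  assumes "a \<in> Poly_Mapping.keys f" "\<And>b. b \<in> Poly_Mapping.keys f \<Longrightarrow> b \<noteq> a \<Longrightarrow> revlex_gt a b"
  shows "lead_mon f = a"
  unfolding lead_mon_def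
proof (rule the_equality)
  show "a \<in> Poly_Mapping.keys f \<and> (\<forall>b\<in>Poly_Mapping.keys f. b \<noteq> a \<longrightarrow> revlex_gt a b)"
    using assms by blast
  fix x assume x: "x \<in> Poly_Mapping.keys f \<and> (\<forall>b\<in>Poly_Mapping.keys f. b \<noteq> x \<longrightarrow> revlex_gt x b)"
  show "x = a"
  proof (rule ccontr)
    assume "x \<noteq> a"
    then have "revlex_gt x a" "revlex_gt a x" using x assms by auto
    then show False using revlex_gt_trans[of x a x] revlex_gt_irrefl by simp
  qed
qed

lemma lead_mon:
  assumes "f \<noteq> 0"
  shows "lead_mon f \<in> Poly_Mapping.keys f" "\<And>b. b \<in> Poly_Mapping.keys f \<Longrightarrow> b \<noteq> lead_mon f \<Longrightarrow> revlex_gt (lead_mon f) b"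
proof -
  have "\<exists>a\<in>A. \<forall>b\<in>A. b \<noteq> a \<longrightarrow> revlex_gt a b" if "finite A" "A \<noteq> {}" for A
    using that
  proof (induction A rule: finite_ne_induct)
    case (insert x A)
    then obtain a where a: "a \<in> A" "\<forall>b\<in>A. b \<noteq> a \<longrightarrow> revlex_gt a b" by blast
    have "x \<noteq> a" using a insert by blast
    then consider "revlex_gt x a" | "revlex_gt a x" using revlex_gt_total by blast
    then show ?case
    proof cases
      case 1
      then have "\<forall>b\<in>insert x A. b \<noteq> x \<longrightarrow> revlex_gt x b" using a revlex_gt_trans by (metis insertE)
      then show ?thesis by blast
    next
      case 2
      then show ?thesis using a by blast
    qed
  qed auto
  then obtain a where "a \<in> Poly_Mapping.keys f" "\<forall>b\<in>Poly_Mapping.keys f. b \<noteq> a \<longrightarrow> revlex_gt a b"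
    using assms by (metis finite_keys keys_eq_empty)
  moreover then have "lead_mon f = a" by (intro lead_mon_eqI) auto
  ultimately show "lead_mon f \<in> Poly_Mapping.keys f"
    "\<And>b. b \<in> Poly_Mapping.keys f \<Longrightarrow> b \<noteq> lead_mon f \<Longrightarrow> revlex_gt (lead_mon f) b" by auto
qed

lemma lookup_sum_single:
  assumes "finite S"
  shows "Poly_Mapping.lookup (\<Sum>b\<in>S. Poly_Mapping.single b (c b)) a = (if a \<in> S then c a else 0)"
  using assms by (simp add: lookup_sum lookup_single when_def)

text \<open>The standard monomials divisible by \<open>x3^c\<close> in degree \<open>t + c\<close> number \<open>min (h t) (h (t + c))\<close>, which
  bounds the rank of multiplication by \<open>x3^c\<close>; being independent they span its image.\<close>
lemma nonstandard_reduction: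
  assumes I: "is_ideal I" and uni: "unimodal (hilb I)" and L: "\<And>t k. layer (hilb I) t k \<le> Suc t"
    and ind: "std_independent I N" and a: "a \<notin> stdset (hilb I)"
  shows "\<exists>p. Poly_Mapping.keys p \<subseteq> {b \<in> stdset (hilb I). revlex_gt a b} \<and> subst3 N (monom a - p) \<in> I"
proof -
  let ?h = "hilb I"
  have sI: "PV.subspace I" by (rule is_ideal_subspace[OF I])
  obtain i j c where ijc: "a = (i,j,c)" by (cases a)
  define t where "t = i + j"
  define l where "l = lin_form N 2"
  have l: "homogeneous 1 l" unfolding l_def by (rule homogeneous_lin_form)
  define S where "S = {b \<in> stdset ?h. mdeg b = t + c \<and> c \<le> snd (snd b)}"
  have finS: "finite S" by (rule finite_subset[OF _ finite_mons[of "t + c"]]) (auto simp: S_def mons_def)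
  have cardS: "card S = min (?h t) (?h (t + c))" unfolding S_def by (rule card_stdset_slice[OF uni L])
  interpret P: Vector_Spaces.linear scal scal "proj I" by (rule linear_proj[OF sI])
  define v where "v b = proj I (mon_subst N b)" for b
  have sub: "(\<Sum>b\<in>S. scal (f b) (v b)) = proj I (subst3 N (\<Sum>b\<in>S. Poly_Mapping.single b (f b)))" for f
    by (simp add: v_def P.sum P.scale subst3_sum subst3_single)
  have keysS: "Poly_Mapping.keys (\<Sum>b\<in>S. Poly_Mapping.single b (f b)) \<subseteq> S" for f :: "mon3 \<Rightarrow> 'a"
    using lookup_sum_single[OF finS, of f] by (metis in_keys_iff subsetI)
  have z: "\<forall>b\<in>S. f b = 0" if "(\<Sum>b\<in>S. scal (f b) (v b)) = 0" for f
  proof -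
    let ?q = "\<Sum>b\<in>S. Poly_Mapping.single b (f b)"
    have "subst3 N ?q \<in> I" using that unfolding sub proj_eq_0_iff[OF sI] .
    moreover have "Poly_Mapping.keys ?q \<subseteq> stdset ?h" using keysS[of f] S_def by blast
    ultimately have "?q = 0" using ind unfolding std_independent_def by blast
    then show ?thesis using lookup_sum_single[OF finS, of f] by (metis lookup_zero)
  qed
  have slice: "mon_subst N b \<in> mimg l c t" if b: "mdeg b = t + c" "c \<le> snd (snd b)" for b
  proof -
    obtain i' j' c' where b': "b = (i',j',c')" by (cases b)
    have "mon_subst N b = l ^ c * mon_subst N (i',j',c'-c)"
      using b b' power_add[of l c "c' - c"] by (simp add: mon_subst_def l_def mult_ac)
    moreover have "mdeg (i',j',c'-c) = t" using b b' by simp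
    then have "mon_subst N (i',j',c'-c) \<in> hspace t"
      using homogeneous_mon_subst[of "(i',j',c'-c)" N] by (simp add: hspace_def)
    ultimately show ?thesis by (auto simp: mimg_def)
  qed
  obtain F :: "'a poly3 set" where F: "finite F" "hspace (t + c) \<subseteq> PV.span F" by (rule hspace_finite_span)
  obtain F' where F': "proj I ` mimg l c t \<subseteq> PV.span F'" "finite F'"
    using proj_image_finite_span[OF sI _ F(1), of "mimg l c t"] F(2) mimg_subset_hspace[OF l, of c t] by blast
  have "proj I ` mimg l c t \<subseteq> PV.span (v ` S)"
  proof (rule PV.independent_card_ge_dim_spans[OF _ _ F'])
    show "v ` S \<subseteq> proj I ` mimg l c t" using slice by (auto simp: v_def S_def)
    show "PV.independent (v ` S)" by (rule PV.independent_family(2)[OF finS z])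
    have "inj_on v S" by (rule PV.independent_family(1)[OF finS z])
    then have "card (v ` S) = min (?h t) (?h (t + c))" by (simp add: card_image cardS)
    then show "PV.dim (proj I ` mimg l c t) \<le> card (v ` S)"
      using rk_mimg_le(1)[OF I l, of c t] by (simp add: rk_def)
  qed
  moreover have "proj I (mon_subst N a) \<in> proj I ` mimg l c t"
    using slice[of a] ijc by (simp add: t_def)
  ultimately obtain f where f: "proj I (mon_subst N a) = (\<Sum>b\<in>S. scal (f b) (v b))"
    using PV.span_image_finite_iff[OF finS] by blast
  let ?p = "\<Sum>b\<in>S. Poly_Mapping.single b (f b)"
  have "subst3 N (monom a - ?p) \<in> I"
  proof -
    interpret S: Vector_Spaces.linear scal scal "subst3 N" by (rule linear_subst3)
    have "proj I (subst3 N (monom a - ?p)) = 0"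
      using f unfolding sub by (simp add: S.diff P.diff subst3_monom)
    then show ?thesis by (simp add: proj_eq_0_iff[OF sI])
  qed
  moreover have "S \<subseteq> {b \<in> stdset ?h. revlex_gt a b}"
  proof
    fix b assume b: "b \<in> S"
    obtain i' j' c' where b': "b = (i',j',c')" by (cases b)
    have d: "i' + j' + c' = i + j + c" "c \<le> c'" "i' < layer ?h (i' + j') c'"
      using b b' by (auto simp: S_def t_def)
    have "revlex_gt a b"
    proof (cases "c' = c")
      case True
      \<comment> \<open>Within one layer standardness is a bound on the first exponent: b meets it
        and a does not. A smaller first exponent means a larger second one, so b is the smaller
        monomial.\<close>
      then have "i' + j' = i + j" "i' < i" using d a ijc by auto
      then show ?thesis using True by (simp add: ijc b' revlex_gt_def)
    next
      case False
      then show ?thesis using d by (simp add: ijc b' revlex_gt_def)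
    qed
    then show "b \<in> {b \<in> stdset ?h. revlex_gt a b}" using b by (simp add: S_def)
  qed
  ultimately show ?thesis using keysS[of f] by blast
qed

text \<open>Reducing \<open>f\<close> to standard monomials gives a combination lying in the ideal,
  hence zero. Were the leading monomial standard, its coefficient would survive, since the other
  monomials of \<open>f\<close> reduce to smaller ones only.\<close>

lemma lead_mon_nonstandard:
  assumes I: "is_ideal I" and uni: "unimodal (hilb I)" and L: "\<And>t k. layer (hilb I) t k \<le> Suc t"
    and ind: "std_independent I N" and f: "subst3 N f \<in> I" "f \<noteq> 0"
  shows "lead_mon f \<notin> stdset (hilb I)"
proof
  assume std: "lead_mon f \<in> stdset (hilb I)"
  let ?m = "lead_mon f"
  have "\<exists>p. Poly_Mapping.keys p \<subseteq> {b \<in> stdset (hilb I). b = a \<or> revlex_gt a b} \<and> subst3 N (monom a - p) \<in> I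
      \<and> (a \<in> stdset (hilb I) \<longrightarrow> p = monom a)" for a
  proof (cases "a \<in> stdset (hilb I)")
    case True
    then show ?thesis using is_idealD(1)[OF I] by (intro exI[of _ "monom a"]) (simp add: monom_def)
  next
    case False
    then show ?thesis using nonstandard_reduction[OF I uni L ind False] by blast
  qed
  then have "\<forall>a. \<exists>p. Poly_Mapping.keys p \<subseteq> {b \<in> stdset (hilb I). b = a \<or> revlex_gt a b}
      \<and> subst3 N (monom a - p) \<in> I \<and> (a \<in> stdset (hilb I) \<longrightarrow> p = monom a)" by (rule allI)
  from choice[OF this] obtain r where
    "\<forall>a. Poly_Mapping.keys (r a) \<subseteq> {b \<in> stdset (hilb I). b = a \<or> revlex_gt a b}
      \<and> subst3 N (monom a - r a) \<in> I \<and> (a \<in> stdset (hilb I) \<longrightarrow> r a = monom a)" by (elim exE)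
  then have r: "\<And>a. Poly_Mapping.keys (r a) \<subseteq> {b \<in> stdset (hilb I). b = a \<or> revlex_gt a b}"
    "\<And>a. subst3 N (monom a - r a) \<in> I" "\<And>a. a \<in> stdset (hilb I) \<Longrightarrow> r a = monom a"
    by (simp_all only: simp_thms)
  define F where "F = (\<Sum>a\<in>Poly_Mapping.keys f. scal (Poly_Mapping.lookup f a) (r a))"
  have lookF: "Poly_Mapping.lookup F b = (\<Sum>a\<in>Poly_Mapping.keys f. Poly_Mapping.lookup f a * Poly_Mapping.lookup (r a) b)" for b
    by (simp add: F_def lookup_sum)
  interpret S: Vector_Spaces.linear scal scal "subst3 N" by (rule linear_subst3)
  have "subst3 N (f - F) = (\<Sum>a\<in>Poly_Mapping.keys f. scal (Poly_Mapping.lookup f a) (subst3 N (monom a - r a)))"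
    by (simp add: F_def S.diff S.sum S.scale PV.scale_right_diff_distrib sum_subtractf subst3_monom
        subst3_alt[OF finite_keys order_refl, of N f])
  also have "\<dots> \<in> I" by (intro is_ideal_sum I is_idealD(4)[OF I] r(2))
  finally have "subst3 N F \<in> I" using is_idealD(5)[OF I f(1)] by (simp add: S.diff) (metis diff_diff_eq2 diff_add_cancel add_diff_cancel_left')
  moreover have "Poly_Mapping.keys F \<subseteq> stdset (hilb I)"
  proof
    fix b assume "b \<in> Poly_Mapping.keys F"
    then have "(\<Sum>a\<in>Poly_Mapping.keys f. Poly_Mapping.lookup f a * Poly_Mapping.lookup (r a) b) \<noteq> 0"
      by (simp add: in_keys_iff lookF)
    then obtain a where "Poly_Mapping.lookup f a * Poly_Mapping.lookup (r a) b \<noteq> 0" by (rule sum.not_neutral_contains_not_neutral)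
    then have "b \<in> Poly_Mapping.keys (r a)" by (simp add: in_keys_iff)
    then show "b \<in> stdset (hilb I)" using r(1) by blast
  qed
  ultimately have "F = 0" using ind unfolding std_independent_def by blast
  moreover have "Poly_Mapping.lookup F ?m = Poly_Mapping.lookup f ?m"
  proof -
    have "Poly_Mapping.lookup (r a) ?m = (if a = ?m then 1 else 0)" if a: "a \<in> Poly_Mapping.keys f" for a
    proof (cases "a = ?m")
      case True
      then show ?thesis using r(3)[OF std] by (simp add: monom_def)
    next
      case False
      then have "revlex_gt ?m a" using lead_mon(2)[OF f(2) a] by blast
      then have "?m \<notin> Poly_Mapping.keys (r a)" using r(1)[of a] revlex_gt_trans revlex_gt_irrefl False by blast
      then show ?thesis using False by (simp add: in_keys_iff)
    qed
    then have "Poly_Mapping.lookup F ?m = (\<Sum>a\<in>Poly_Mapping.keys f. if a = ?m then Poly_Mapping.lookup f a else 0)"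
      unfolding lookF by (intro sum.cong) simp_all
    then show ?thesis using lead_mon(1)[OF f(2)] by simp
  qed
  ultimately show False using lead_mon(1)[OF f(2)] by (simp add: in_keys_iff)
qed

text \<open>Multiplying the reduction of \<open>a\<close> by \<open>w\<close> preserves its leading
  term. The general \<open>w\<close> serves to show that nonstandard monomials are closed under
  multiples.\<close>

lemma lead_mon_surj:
  assumes I: "is_ideal I" and uni: "unimodal (hilb I)" and L: "\<And>t k. layer (hilb I) t k \<le> Suc t"
    and ind: "std_independent I N" and a: "a \<notin> stdset (hilb I)"
  shows "\<exists>f. subst3 N f \<in> I \<and> f \<noteq> 0 \<and> lead_mon f = w + a"
proof -
  obtain p where p: "Poly_Mapping.keys p \<subseteq> {b \<in> stdset (hilb I). revlex_gt a b}" "subst3 N (monom a - p) \<in> I"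
    using nonstandard_reduction[OF assms] by blast
  let ?f = "monom w * (monom a - p)"
  have f: "?f = monom (w + a) - monom w * p" by (simp add: monom_add algebra_simps)
  have kp: "revlex_gt (w + a) b" if b: "b \<in> Poly_Mapping.keys (monom w * p)" for b
  proof -
    obtain c d where "b = c + d" "c \<in> Poly_Mapping.keys (monom w :: 'a poly3)" "d \<in> Poly_Mapping.keys p"
      using subsetD[OF keys_mult b] by blast
    then show ?thesis using p(1) revlex_gt_add[of a d w] by (auto simp: monom_def)
  qed
  then have "w + a \<notin> Poly_Mapping.keys (monom w * p)" using revlex_gt_irrefl by blast
  then have "Poly_Mapping.lookup ?f (w + a) = 1"
    by (simp add: f lookup_minus in_keys_iff) (simp add: monom_def)
  then have wa: "w + a \<in> Poly_Mapping.keys ?f" by (simp add: in_keys_iff)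
  moreover have "revlex_gt (w + a) b" if "b \<in> Poly_Mapping.keys ?f" "b \<noteq> w + a" for b
  proof (rule kp)
    show "b \<in> Poly_Mapping.keys (monom w * p)"
      using that by (simp add: f in_keys_iff lookup_minus) (simp add: monom_def lookup_single)
  qed
  ultimately have "lead_mon ?f = w + a" by (intro lead_mon_eqI)
  moreover have "?f \<noteq> 0" using wa by (metis empty_iff keys_zero)
  moreover have "subst3 N ?f \<in> I" using is_idealD(3)[OF I p(2)] by (simp add: subst3_mult)
  ultimately show ?thesis by blast
qed

text \<open>This is read off from the ideal and not from the formula for \<open>layer\<close>: the
  multiple is a leading monomial of the transformed ideal.\<close>

lemma nonstandard_upward_closed:
  assumes "is_ideal I" "unimodal (hilb I)" "\<And>t k. layer (hilb I) t k \<le> Suc t"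
    "std_independent I N" "a \<notin> stdset (hilb I)"
  shows "w + a \<notin> stdset (hilb I)"
  using lead_mon_surj[OF assms, of w] lead_mon_nonstandard[OF assms(1-4)] by metis

lemma initial_ideal_act:
  assumes "is_ideal I" "unimodal (hilb I)" "\<And>t k. layer (hilb I) t k \<le> Suc t"
    and ind: "std_independent I N"
    and inv: "\<And>p. subst3 M (subst3 N p) = p" "\<And>p. subst3 N (subst3 M p) = p"
  shows "initial_ideal (act_ideal M I) = ideal_gen {monom a | a. a \<notin> stdset (hilb I)}"
proof -
  have act: "f \<in> act_ideal M I \<longleftrightarrow> subst3 N f \<in> I" for f
    unfolding act_ideal_def using inv by (metis imageE image_eqI)
  have "{monom (lead_mon f) | f. f \<in> act_ideal M I \<and> f \<noteq> 0} = {monom a | a. a \<notin> stdset (hilb I)}"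
  proof (intro subset_antisym subsetI)
    fix x assume "x \<in> {monom a | a. a \<notin> stdset (hilb I)}"
    then obtain a where "x = monom a" "a \<notin> stdset (hilb I)" by blast
    then show "x \<in> {monom (lead_mon f) | f. f \<in> act_ideal M I \<and> f \<noteq> 0}"
      using lead_mon_surj[OF assms(1-4), of a 0] unfolding act by auto
  next
    fix x assume "x \<in> {monom (lead_mon f) | f. f \<in> act_ideal M I \<and> f \<noteq> 0}"
    then obtain f where "x = monom (lead_mon f)" "subst3 N f \<in> I" "f \<noteq> 0" unfolding act by blast
    then show "x \<in> {monom a | a. a \<notin> stdset (hilb I)}"
      using lead_mon_nonstandard[OF assms(1-4)] by blast
  qed
  then show ?thesis unfolding initial_ideal_def by (rule arg_cong)
qed

text \<open>Polynomials whose support avoids \<open>B\<close> form an ideal containing the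
  generators.\<close>

lemma monom_in_nonstandard_ideal_iff:
  assumes up: "\<And>w a. a \<notin> B \<Longrightarrow> w + a \<notin> B"
  shows "(monom b :: 'a::field poly3) \<in> ideal_gen {monom a | a. a \<notin> B} \<longleftrightarrow> b \<notin> B"
proof
  let ?Z = "{p :: 'a poly3. Poly_Mapping.keys p \<inter> B = {}}"
  have "is_ideal ?Z"
    unfolding is_ideal_def
  proof (intro conjI ballI allI)
    fix p q :: "'a poly3" assume "p \<in> ?Z" "q \<in> ?Z"
    then show "p + q \<in> ?Z" using keys_add[of p q] by blast
  next
    fix p q :: "'a poly3" assume p: "p \<in> ?Z"
    have "b \<notin> B" if b: "b \<in> Poly_Mapping.keys (q * p)" for b
    proof -
      obtain c d where "b = c + d" "d \<in> Poly_Mapping.keys p"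
        using subsetD[OF keys_mult b] by blast
      then show ?thesis using p up by blast
    qed
    then show "q * p \<in> ?Z" by blast
  qed simp
  then have "ideal_gen {monom a | a. a \<notin> B} \<subseteq> ?Z"
    by (rule ideal_gen_minimal) (auto simp: monom_def)
  moreover assume "(monom b :: 'a poly3) \<in> ideal_gen {monom a | a. a \<notin> B}"
  ultimately show "b \<notin> B" by (auto simp: monom_def)
next
  assume "b \<notin> B"
  then show "(monom b :: 'a poly3) \<in> ideal_gen {monom a | a. a \<notin> B}" by (intro in_ideal_gen) blast
qed

text \<open>Minimality of the generator u enters through the divisor u / x3, which it makes
  standard.\<close>

lemma almost_revlex_nonstandard:
  assumes up: "\<And>w a. a \<notin> stdset h \<Longrightarrow> w + a \<notin> stdset h" and uni: "unimodal h"
  shows "almost_revlex (ideal_gen {monom a | a. a \<notin> stdset h} :: 'a::field poly3 set)"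
  unfolding almost_revlex_def
proof (intro allI impI, elim conjE)
  let ?J = "ideal_gen {monom a | a. a \<notin> stdset h} :: 'a poly3 set"
  note J = monom_in_nonstandard_ideal_iff[of "stdset h", OF up]
  fix u v assume u: "min_mon_gen ?J u" and v: "mdeg v = mdeg u" "revlex_gt v u"
  obtain i j c where ijc: "u = (i,j,c)" by (cases u)
  obtain i' j' c' where ijc': "v = (i',j',c')" by (cases v)
  have "v \<notin> stdset h"
    unfolding ijc'
  proof (rule stdset_almost_revlex[OF uni, of i j c])
    show "(i,j,c) \<notin> stdset h" using u J unfolding min_mon_gen_def ijc by blast
    show "(i,j,c-1) \<in> stdset h" if "c > 0"
    proof -
      have "mon_dvd (i,j,c-1) u" "(i,j,c-1) \<noteq> u" using that by (auto simp: ijc mon_dvd_def)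
      then show ?thesis using u J unfolding min_mon_gen_def by blast
    qed
  qed (use v ijc ijc' in auto)
  then show "monom v \<in> ?J" using J by blast
qed

subsection \<open>Openness\<close>

definition mat_mono :: "(nat \<times> nat \<Rightarrow>\<^sub>0 nat) \<Rightarrow> (nat \<Rightarrow> nat \<Rightarrow> 'a::comm_ring_1) \<Rightarrow> 'a" where
  "mat_mono m M = (\<Prod>ij\<in>Poly_Mapping.keys m. M (fst ij) (snd ij) ^ Poly_Mapping.lookup m ij)"

lemma mat_mono_alt:
  assumes "finite A" "Poly_Mapping.keys m \<subseteq> A"
  shows "mat_mono m M = (\<Prod>ij\<in>A. M (fst ij) (snd ij) ^ Poly_Mapping.lookup m ij)"
  unfolding mat_mono_def by (rule prod.mono_neutral_left) (use assms in \<open>auto simp: in_keys_iff\<close>)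

lemma mat_mono_add: "mat_mono (m + m') M = mat_mono m M * mat_mono m' M"
proof -
  let ?A = "Poly_Mapping.keys m \<union> Poly_Mapping.keys m'"
  have "Poly_Mapping.keys (m + m') \<subseteq> ?A" by (rule keys_add)
  then show ?thesis
    by (simp add: mat_mono_alt[of ?A] lookup_add power_add prod.distrib)
qed

lemma eval_mat_alt:
  assumes "finite A" "Poly_Mapping.keys P \<subseteq> A"
  shows "eval_mat P M = (\<Sum>m\<in>A. Poly_Mapping.lookup P m * mat_mono m M)"
  unfolding eval_mat_def mat_mono_def[symmetric]
  by (rule sum.mono_neutral_left) (use assms in \<open>auto simp: in_keys_iff\<close>)

lemma eval_mat_add: "eval_mat (P + Q) M = eval_mat P M + eval_mat Q M"
proof -
  let ?A = "Poly_Mapping.keys P \<union> Poly_Mapping.keys Q"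
  have "Poly_Mapping.keys (P + Q) \<subseteq> ?A" by (rule keys_add)
  then show ?thesis
    by (simp add: eval_mat_alt[of ?A] lookup_add distrib_right sum.distrib)
qed

lemma eval_mat_single: "eval_mat (Poly_Mapping.single m c) M = c * mat_mono m M"
  by (subst eval_mat_alt[of "{m}"]) auto

lemma eval_mat_0: "eval_mat 0 M = 0"
  by (simp add: eval_mat_def)

lemma eval_mat_mult: "eval_mat (P * Q) M = eval_mat P M * eval_mat Q M"
proof (induction P rule: poly_mapping_single_induct)
  case (single a c)
  show ?case
    by (induction Q rule: poly_mapping_single_induct)
      (simp_all add: mult_single eval_mat_single mat_mono_add distrib_left distrib_right eval_mat_add eval_mat_0 mult_ac)
qed (simp_all add: distrib_right eval_mat_add eval_mat_0)

definition polyfun :: "((nat \<Rightarrow> nat \<Rightarrow> 'a::comm_ring_1) \<Rightarrow> 'a) \<Rightarrow> bool" where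
  "polyfun F \<longleftrightarrow> (\<exists>P. mat_poly P \<and> F = eval_mat P)"

lemma polyfun_const: "polyfun (\<lambda>M. c)"
proof -
  have "mat_poly (Poly_Mapping.single 0 c)" by (simp add: mat_poly_def)
  moreover have "(\<lambda>M. c) = eval_mat (Poly_Mapping.single 0 c)"
    by (simp add: fun_eq_iff eval_mat_single mat_mono_def)
  ultimately show ?thesis unfolding polyfun_def by blast
qed

lemma polyfun_entry:
  assumes "i < 3" "j < 3"
  shows "polyfun (\<lambda>M. M i j)"
proof -
  let ?P = "Poly_Mapping.single (Poly_Mapping.single (i,j) 1) 1 :: ((nat \<times> nat) \<Rightarrow>\<^sub>0 nat) \<Rightarrow>\<^sub>0 'a"
  have "mat_poly ?P" using assms by (simp add: mat_poly_def)
  moreover have "(\<lambda>M. M i j) = eval_mat ?P"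
    by (simp add: fun_eq_iff eval_mat_single mat_mono_def)
  ultimately show ?thesis unfolding polyfun_def by blast
qed

lemma polyfun_add:
  assumes "polyfun F" "polyfun G"
  shows "polyfun (\<lambda>M. F M + G M)"
proof -
  obtain P Q where PQ: "mat_poly P" "F = eval_mat P" "mat_poly Q" "G = eval_mat Q"
    using assms unfolding polyfun_def by blast
  have "mat_poly (P + Q)" using PQ keys_add[of P Q] unfolding mat_poly_def by blast
  moreover have "(\<lambda>M. F M + G M) = eval_mat (P + Q)" by (simp add: PQ eval_mat_add fun_eq_iff)
  ultimately show ?thesis unfolding polyfun_def by blast
qed

lemma polyfun_mult:
  assumes "polyfun F" "polyfun G"
  shows "polyfun (\<lambda>M. F M * G M)"
proof -
  obtain P Q where PQ: "mat_poly P" "F = eval_mat P" "mat_poly Q" "G = eval_mat Q"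
    using assms unfolding polyfun_def by blast
  have "Poly_Mapping.keys m \<subseteq> {0..<3} \<times> {0..<3}" if m: "m \<in> Poly_Mapping.keys (P * Q)" for m
  proof -
    obtain a b where "m = a + b" "a \<in> Poly_Mapping.keys P" "b \<in> Poly_Mapping.keys Q"
      using subsetD[OF keys_mult m] by blast
    then show ?thesis using PQ keys_add[of a b] unfolding mat_poly_def by blast
  qed
  then have "mat_poly (P * Q)" unfolding mat_poly_def by blast
  moreover have "(\<lambda>M. F M * G M) = eval_mat (P * Q)" by (simp add: PQ eval_mat_mult fun_eq_iff)
  ultimately show ?thesis unfolding polyfun_def by blast
qed

lemma polyfun_uminus: "polyfun F \<Longrightarrow> polyfun (\<lambda>M. - F M)"
  using polyfun_mult[OF polyfun_const[of "-1"]] by simp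

lemma polyfun_diff: "polyfun F \<Longrightarrow> polyfun G \<Longrightarrow> polyfun (\<lambda>M. F M - G M)"
  using polyfun_add[OF _ polyfun_uminus] by simp

lemma polyfun_adj3:
  assumes "i < 3" "j < 3"
  shows "polyfun (\<lambda>M. adj3 M i j)"
  using assms unfolding less_3_cases
  by (elim disjE; simp add: adj3_def; intro polyfun_diff polyfun_mult polyfun_entry; simp)

text \<open>Finitely many fixed monomials with polynomial functions as coefficients: the support is
  bounded independently of the matrix, so a linear map can be applied term by term.\<close>

inductive poly_family :: "((nat \<Rightarrow> nat \<Rightarrow> 'a::comm_ring_1) \<Rightarrow> 'a poly3) \<Rightarrow> bool" where
  single: "polyfun c \<Longrightarrow> poly_family (\<lambda>M. Poly_Mapping.single a (c M))"
| add: "poly_family F \<Longrightarrow> poly_family G \<Longrightarrow> poly_family (\<lambda>M. F M + G M)"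

lemma poly_family_mult:
  assumes "poly_family F" "poly_family G"
  shows "poly_family (\<lambda>M. F M * G M)"
  using assms(1)
proof induction
  case (single c a)
  note c = single
  show ?case using assms(2)
  proof induction
    case (single d b)
    show ?case unfolding mult_single by (intro poly_family.single polyfun_mult c single)
  next
    case (add F G)
    then show ?case unfolding distrib_left by (intro poly_family.add)
  qed
next
  case (add F G)
  then show ?case unfolding distrib_right by (intro poly_family.add)
qed

lemma poly_family_const_1: "poly_family (\<lambda>M. 1)"
  using poly_family.single[OF polyfun_const[of 1], of 0] by simp

lemma poly_family_power: "poly_family F \<Longrightarrow> poly_family (\<lambda>M. F M ^ n)"
  by (induction n) (auto intro: poly_family_mult poly_family_const_1)

lemma poly_family_mon_subst_adj3: "poly_family (\<lambda>M. mon_subst (adj3 M) a)"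
proof -
  have lf: "poly_family (\<lambda>M. lin_form (adj3 M) j)" if "j < 3" for j
    unfolding lin_form_alt monom_def scal_single using that
    by (intro poly_family.intros polyfun_mult polyfun_adj3 polyfun_const) auto
  then show ?thesis unfolding mon_subst_def by (intro poly_family_mult poly_family_power lf) auto
qed

lemma polyfun_lookup_linear:
  assumes "Vector_Spaces.linear scal scal \<phi>" "poly_family F"
  shows "polyfun (\<lambda>M. Poly_Mapping.lookup (\<phi> (F M)) j)"
proof -
  interpret f: Vector_Spaces.linear scal scal \<phi> by (rule assms(1))
  show ?thesis
    using assms(2)
  proof induction
    case (single c a)
    show ?case unfolding single_eq_scal_monom f.scale lookup_scal by (intro polyfun_mult single polyfun_const)
  next
    case (add F G)
    show ?case unfolding f.add lookup_add by (intro polyfun_add add.IH)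
  qed
qed

text \<open>One step of Gaussian elimination in the induction replaces the usual determinant.\<close>
lemma independence_locally_open:
  fixes v :: "'b \<Rightarrow> (nat \<Rightarrow> nat \<Rightarrow> 'a::field) \<Rightarrow> 'j \<Rightarrow> 'a"
  assumes "finite B" "\<And>b j. polyfun (\<lambda>M. v b M j)"
    "\<And>c. (\<And>j. (\<Sum>b\<in>B. c b * v b M0 j) = 0) \<Longrightarrow> \<forall>b\<in>B. c b = 0"
  shows "\<exists>P. polyfun P \<and> P M0 \<noteq> 0 \<and>
    (\<forall>M c. P M \<noteq> 0 \<longrightarrow> (\<forall>j. (\<Sum>b\<in>B. c b * v b M j) = 0) \<longrightarrow> (\<forall>b\<in>B. c b = 0))"
  using assms
proof (induction B arbitrary: v rule: finite_induct)
  case empty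
  show ?case by (intro exI[of _ "\<lambda>_. 1"]) (simp add: polyfun_const)
next
  case (insert x B)
  have ind: "\<forall>b\<in>insert x B. c b = 0" if "\<And>j. c x * v x M0 j + (\<Sum>b\<in>B. c b * v b M0 j) = 0" for c
    using insert.prems(2)[of c] that insert.hyps by simp
  obtain j0 where j0: "v x M0 j0 \<noteq> 0"
  proof (rule ccontr)
    assume "\<not> thesis"
    then have "v x M0 j = 0" for j using that by blast
    then have "\<forall>b\<in>insert x B. (if b = x then 1 else 0 :: 'a) = 0"
      using insert.hyps by (intro ind) (auto intro!: sum.neutral)
    then show False by simp
  qed
  \<comment> \<open>Elimination with pivot \<open>v x M j0\<close>, cleared of denominators so that
    the entries remain polynomial functions.\<close>
  define w where "w b M j = v x M j0 * v b M j - v b M j0 * v x M j" for b M j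
  have w_sum: "(\<Sum>b\<in>B. c b * w b M j) = v x M j0 * (\<Sum>b\<in>B. c b * v b M j) - (\<Sum>b\<in>B. c b * v b M j0) * v x M j" for c M j
    by (simp add: w_def algebra_simps sum_subtractf sum_distrib_left sum_distrib_right)
  have "\<exists>P. polyfun P \<and> P M0 \<noteq> 0 \<and>
    (\<forall>M c. P M \<noteq> 0 \<longrightarrow> (\<forall>j. (\<Sum>b\<in>B. c b * w b M j) = 0) \<longrightarrow> (\<forall>b\<in>B. c b = 0))"
  proof (rule insert.IH)
    show "polyfun (\<lambda>M. w b M j)" for b j
      unfolding w_def by (intro polyfun_diff polyfun_mult insert.prems(1))
    fix c assume c: "\<And>j. (\<Sum>b\<in>B. c b * w b M0 j) = 0"
    \<comment> \<open>Lifts a relation among the eliminated rows to the original ones; the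
      coefficient at \<open>x\<close> makes the pivot column cancel.\<close>
    let ?d = "\<lambda>b. if b = x then - (\<Sum>b\<in>B. c b * v b M0 j0) else v x M0 j0 * c b"
    have "\<forall>b\<in>insert x B. ?d b = 0"
    proof (rule ind)
      fix j
      have "(\<Sum>b\<in>B. ?d b * v b M0 j) = (\<Sum>b\<in>B. v x M0 j0 * (c b * v b M0 j))"
        by (rule sum.cong) (use insert.hyps in auto)
      then show "?d x * v x M0 j + (\<Sum>b\<in>B. ?d b * v b M0 j) = 0"
        using c[of j] unfolding w_sum by (simp add: sum_distrib_left[symmetric])
    qed
    then have "v x M0 j0 * c b = 0" if "b \<in> B" for b
      using that insert.hyps(2) by (metis insertI2)
    then show "\<forall>b\<in>B. c b = 0" using j0 by simp
  qed
  then obtain P where P: "polyfun P" "P M0 \<noteq> 0"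
    "\<And>M c. P M \<noteq> 0 \<Longrightarrow> (\<forall>j. (\<Sum>b\<in>B. c b * w b M j) = 0) \<Longrightarrow> (\<forall>b\<in>B. c b = 0)" by blast
  have "\<forall>b\<in>insert x B. c b = 0"
    if M: "P M * v x M j0 \<noteq> 0" and c: "\<forall>j. (\<Sum>b\<in>insert x B. c b * v b M j) = 0" for M c
  proof -
    have s: "(\<Sum>b\<in>B. c b * v b M j) = - (c x * v x M j)" for j
      using spec[OF c, of j] insert.hyps by (simp add: eq_neg_iff_add_eq_0 add.commute)
    have "(\<Sum>b\<in>B. c b * w b M j) = 0" for j unfolding w_sum s by simp
    then have 0: "\<forall>b\<in>B. c b = 0" using P(3)[of M c] M by simp
    then have "c x * v x M j0 = 0" using s[of j0] by simp
    then show ?thesis using 0 M by simp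
  qed
  moreover have "polyfun (\<lambda>M. P M * v x M j0)" by (intro polyfun_mult P(1) insert.prems(1))
  moreover have "P M0 * v x M0 j0 \<noteq> 0" using P(2) j0 by simp
  ultimately show ?case by (intro exI[of _ "\<lambda>M. P M * v x M j0"]) blast
qed

text \<open>Restates independence as triviality of a linear system with finitely many unknowns, the
  form in which \<open>independence_locally_open\<close> applies.\<close>

lemma std_independent_iff:
  assumes I: "PV.subspace I" and fin: "finite (stdset (hilb I))"
  shows "std_independent I N \<longleftrightarrow> (\<forall>c.
    (\<forall>j. (\<Sum>b\<in>stdset (hilb I). c b * Poly_Mapping.lookup (proj I (mon_subst N b)) j) = 0) \<longrightarrow> (\<forall>b\<in>stdset (hilb I). c b = 0))"
proof -
  let ?B = "stdset (hilb I)"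
  interpret P: Vector_Spaces.linear scal scal "proj I" by (rule linear_proj[OF I])
  let ?q = "\<lambda>c. \<Sum>b\<in>?B. Poly_Mapping.single b (c b)"
  have eq: "(\<forall>j. (\<Sum>b\<in>?B. c b * Poly_Mapping.lookup (proj I (mon_subst N b)) j) = 0) \<longleftrightarrow> subst3 N (?q c) \<in> I" for c
  proof -
    have "proj I (subst3 N (?q c)) = (\<Sum>b\<in>?B. scal (c b) (proj I (mon_subst N b)))"
      by (simp add: P.sum P.scale subst3_sum subst3_single)
    then have "(\<Sum>b\<in>?B. c b * Poly_Mapping.lookup (proj I (mon_subst N b)) j) = Poly_Mapping.lookup (proj I (subst3 N (?q c))) j" for j
      by (simp add: lookup_sum)
    then show ?thesis unfolding proj_eq_0_iff[OF I, symmetric] poly_mapping_eq_iff by (simp add: fun_eq_iff)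
  qed
  have lk: "Poly_Mapping.lookup (?q c) a = (if a \<in> ?B then c a else 0)" for c :: "mon3 \<Rightarrow> 'a" and a
    by (rule lookup_sum_single[OF fin])
  have keysq: "Poly_Mapping.keys (?q c) \<subseteq> ?B" for c :: "mon3 \<Rightarrow> 'a"
  proof
    fix a assume "a \<in> Poly_Mapping.keys (?q c)"
    then show "a \<in> ?B" unfolding in_keys_iff lk by (rule contrapos_np) simp
  qed
  have q0: "?q c = 0 \<longleftrightarrow> (\<forall>b\<in>?B. c b = 0)" for c :: "mon3 \<Rightarrow> 'a"
  proof
    assume "?q c = 0"
    then have "(if a \<in> ?B then c a else 0) = 0" for a unfolding lk[symmetric] by simp
    then show "\<forall>b\<in>?B. c b = 0" by meson
  next
    assume "\<forall>b\<in>?B. c b = 0"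
    then show "?q c = 0" by (intro poly_mapping_eqI) (simp only: lk lookup_zero if_cancel cong: if_cong)
  qed
  show ?thesis
    unfolding eq q0[symmetric] std_independent_def
  proof (intro iffI allI impI)
    fix c assume "\<forall>p. Poly_Mapping.keys p \<subseteq> ?B \<longrightarrow> subst3 N p \<in> I \<longrightarrow> p = 0" "subst3 N (?q c) \<in> I"
    then show "?q c = 0" using keysq by blast
  next
    fix p assume *: "\<forall>c. subst3 N (?q c) \<in> I \<longrightarrow> ?q c = 0" and p: "Poly_Mapping.keys p \<subseteq> ?B" "subst3 N p \<in> I"
    have "?q (Poly_Mapping.lookup p) = p" by (rule sum_single_lookup[OF fin p(1)])
    then show "p = 0" using * p(2) by metis
  qed
qed

text \<open>The set of all polynomials whose nonvanishing implies independence defines the open set.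
  At each of its points local openness supplies one that does not vanish there.\<close>

lemma zariski_open_std_independent:
  assumes I: "PV.subspace I" and fin: "finite (stdset (hilb I))"
  shows "zariski_open_GL3 {M \<in> GL3. std_independent I (adj3 M)}"
proof -
  let ?B = "stdset (hilb I)"
  let ?T = "{P. mat_poly P \<and> (\<forall>M. eval_mat P M \<noteq> 0 \<longrightarrow> std_independent I (adj3 M))}"
  have "\<exists>P\<in>?T. eval_mat P M0 \<noteq> 0" if M0: "std_independent I (adj3 M0)" for M0
  proof -
    have "\<exists>P. polyfun P \<and> P M0 \<noteq> 0 \<and> (\<forall>M c. P M \<noteq> 0 \<longrightarrow>
        (\<forall>j. (\<Sum>b\<in>?B. c b * Poly_Mapping.lookup (proj I (mon_subst (adj3 M) b)) j) = 0) \<longrightarrow> (\<forall>b\<in>?B. c b = 0))"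
    proof (rule independence_locally_open[OF fin])
      show "polyfun (\<lambda>M. Poly_Mapping.lookup (proj I (mon_subst (adj3 M) b)) j)" for b j
        by (rule polyfun_lookup_linear[OF linear_proj[OF I] poly_family_mon_subst_adj3])
      fix c assume "\<And>j. (\<Sum>b\<in>?B. c b * Poly_Mapping.lookup (proj I (mon_subst (adj3 M0) b)) j) = 0"
      then show "\<forall>b\<in>?B. c b = 0" using M0 unfolding std_independent_iff[OF I fin] by simp
    qed
    then obtain P where P: "polyfun P" "P M0 \<noteq> 0" "\<forall>M c. P M \<noteq> 0 \<longrightarrow>
        (\<forall>j. (\<Sum>b\<in>?B. c b * Poly_Mapping.lookup (proj I (mon_subst (adj3 M) b)) j) = 0) \<longrightarrow> (\<forall>b\<in>?B. c b = 0)"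
      by (elim exE conjE)
    obtain Q where Q: "mat_poly Q" "P = eval_mat Q" using P(1) unfolding polyfun_def by blast
    have "std_independent I (adj3 M)" if "eval_mat Q M \<noteq> 0" for M
      unfolding std_independent_iff[OF I fin] using P(3) that Q(2) by simp
    then show ?thesis using Q P(2) by blast
  qed
  then have "{M \<in> GL3. std_independent I (adj3 M)} = {M \<in> GL3. \<exists>P\<in>?T. eval_mat P M \<noteq> 0}" by blast
  moreover have "\<forall>P\<in>?T. mat_poly P" by blast
  ultimately show ?thesis unfolding zariski_open_GL3_def by blast
qed

text \<open>A factor c in the matrix multiplies the coefficients in degree e by c^e and leaves the
  support of a relation unchanged. This exchanges the adjugate for the inverse.\<close>

lemma std_independent_scale:
  fixes N :: "nat \<Rightarrow> nat \<Rightarrow> 'a::field"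
  assumes "std_independent I N" "c \<noteq> 0" "\<And>i j. i < 3 \<Longrightarrow> j < 3 \<Longrightarrow> N' i j = c * N i j"
  shows "std_independent I N'"
  unfolding std_independent_def
proof (intro allI impI)
  fix p assume p: "Poly_Mapping.keys p \<subseteq> stdset (hilb I)" "subst3 N' p \<in> I"
  let ?C = "\<lambda>i j. if i = j then c else 0 :: 'a"
  have lk: "Poly_Mapping.lookup (subst3 ?C p) a = c ^ mdeg a * Poly_Mapping.lookup p a" for a
    by (rule lookup_subst3_scalar_matrix) simp
  have "subst3 N' p = subst3 (mat_mul N ?C) p"
  proof (rule subst3_cong)
    fix i j :: nat assume ij: "i < 3" "j < 3"
    have "mat_mul N ?C i j = (\<Sum>k<3. if k = j then N i k * c else 0)"
      unfolding mat_mul_def by (rule sum.cong) auto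
    also have "\<dots> = N i j * c" using ij by simp
    finally show "N' i j = mat_mul N ?C i j" using assms(3)[OF ij] by (simp add: mult.commute)
  qed
  then have "subst3 N (subst3 ?C p) \<in> I" using p(2) by (simp add: subst3_subst3)
  moreover have "Poly_Mapping.keys (subst3 ?C p) \<subseteq> stdset (hilb I)"
  proof
    fix a assume "a \<in> Poly_Mapping.keys (subst3 ?C p)"
    then have "Poly_Mapping.lookup p a \<noteq> 0" unfolding in_keys_iff lk by simp
    then show "a \<in> stdset (hilb I)" using p(1) by (auto simp only: in_keys_iff)
  qed
  ultimately have "subst3 ?C p = 0" using assms(1) unfolding std_independent_def by blast
  then have "Poly_Mapping.lookup p a = 0" for a using lk[of a] assms(2) by simp
  then show "p = 0" by (intro poly_mapping_eqI) simp
qed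

lemma subst3_inverse:
  fixes M :: "nat \<Rightarrow> nat \<Rightarrow> 'a::field"
  assumes "det3 M \<noteq> 0"
  defines "N \<equiv> \<lambda>i j. inverse (det3 M) * adj3 M i j"
  shows "subst3 M (subst3 N p) = p" "subst3 N (subst3 M p) = p"
proof -
  have 1: "mat_mul M N i j = (if i = j then 1 else 0)" "mat_mul N M i j = (if i = j then 1 else 0)" if "i < 3" "j < 3" for i j
  proof -
    have "mat_mul M N i j = inverse (det3 M) * mat_mul M (adj3 M) i j"
      "mat_mul N M i j = inverse (det3 M) * mat_mul (adj3 M) M i j"
      by (simp_all add: mat_mul_def N_def sum_distrib_left mult_ac)
    then show "mat_mul M N i j = (if i = j then 1 else 0)" "mat_mul N M i j = (if i = j then 1 else 0)"
      using mat_mul_adj3[OF that, of M] assms(1) by simp_all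
  qed
  show "subst3 M (subst3 N p) = p"
    unfolding subst3_subst3 by (rule poly_mapping_eqI, subst lookup_subst3_scalar_matrix[OF 1(1)]) simp_all
  show "subst3 N (subst3 M p) = p"
    unfolding subst3_subst3 by (rule poly_mapping_eqI, subst lookup_subst3_scalar_matrix[OF 1(2)]) simp_all
qed

lemma adj3_adj3:
  assumes "i < 3" "j < 3"
  shows "adj3 (adj3 M) i j = det3 M * M i j"
  using assms unfolding less_3_cases
  by (elim disjE; simp add: adj3_def det3_def; simp add: algebra_simps)

lemma det3_adj3: "det3 (adj3 M) = det3 M ^ 2"
  by (simp add: adj3_def det3_def; simp add: algebra_simps power2_eq_square)

lemma gin_of_lefschetz_ideal:
  fixes I :: "'a::field_char_0 poly3 set"
  assumes gr: "graded_ideal I" and one: "1 \<notin> I" and slp: "strong_lefschetz I"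
    and D: "\<And>e. D \<le> e \<Longrightarrow> hilb I e = 0"
  defines "J \<equiv> ideal_gen {monom a | a. a \<notin> stdset (hilb I)}"
  shows "is_gin I J" "almost_revlex J"
proof -
  have I: "is_ideal I" using gr by (simp add: graded_ideal_def)
  have sI: "PV.subspace I" by (rule is_ideal_subspace[OF I])
  obtain l where l: "lefschetz_element I l" "l \<noteq> 0"
    using strong_lefschetz_nonzero_element[OF I one slp] by blast
  have uni: "unimodal (hilb I)"
    unfolding unimodal_def using lefschetz_unimodal[OF I l(1)] by blast
  have hom: "homogeneous 1 l" using l(1) by (simp add: lefschetz_element_def)
  obtain M where M: "det3 M \<noteq> 0" "lin_form M 2 = l" by (rule exists_matrix_with_column[OF hom l(2)])
  have L: "layer (hilb I) t k \<le> Suc t" for t k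
    by (rule generic_layer_independent(1)[OF I _ M(1) refl]) (simp add: M(2) l(1))
  obtain N where N: "det3 N \<noteq> 0" "std_independent I N"
    using exists_std_independent[OF gr l D] by blast
  have fin: "finite (stdset (hilb I))" using finite_stdset(1)[of D "hilb I"] D by blast
  let ?U = "{M \<in> GL3. std_independent I (adj3 M)}"
  \<comment> \<open>The double adjugate of \<open>N\<close> is a nonzero multiple of
    \<open>N\<close>, so the adjugate of a good \<open>N\<close> is a point of the open set.\<close>
  have "adj3 N \<in> ?U"
  proof -
    have "std_independent I (adj3 (adj3 N))"
      by (rule std_independent_scale[OF N(2) N(1)]) (rule adj3_adj3)
    then show ?thesis using N(1) by (simp add: GL3_def det3_adj3)
  qed
  moreover have "initial_ideal (act_ideal M I) = J" if "M \<in> ?U" for M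
  proof -
    have M: "det3 M \<noteq> 0" "std_independent I (adj3 M)" using that by (simp_all add: GL3_def)
    have "std_independent I (\<lambda>i j. inverse (det3 M) * adj3 M i j)"
      by (rule std_independent_scale[OF M(2), of "inverse (det3 M)"]) (use M(1) in simp_all)
    then show ?thesis
      unfolding J_def by (rule initial_ideal_act[OF I uni L]) (rule subst3_inverse[OF M(1)])+
  qed
  ultimately show "is_gin I J"
    unfolding is_gin_def using zariski_open_std_independent[OF sI fin] by blast
  show "almost_revlex J"
    unfolding J_def by (rule almost_revlex_nonstandard[OF nonstandard_upward_closed[OF I uni L N(2)] uni])
qed

theorem theorem1p1:
  fixes f1 f2 f3 g1 g2 g3 :: "'a::field_char_0 poly3"
    and d1 d2 d3 :: nat
  assumes "d1 > 0" "d2 > 0" "d3 > 0"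
    and "regular_seq3 f1 f2 f3"
    and "homogeneous d1 f1" "homogeneous d2 f2" "homogeneous d3 f3"
    and "strong_lefschetz (ideal_gen {f1, f2, f3})"
    and "regular_seq3 g1 g2 g3"
    and "homogeneous d1 g1" "homogeneous d2 g2" "homogeneous d3 g3"
    and "strong_lefschetz (ideal_gen {g1, g2, g3})"
  shows "\<exists>J. is_gin (ideal_gen {f1, f2, f3}) J \<and> is_gin (ideal_gen {g1, g2, g3}) J
             \<and> almost_revlex J"
proof -
  let ?I = "ideal_gen {f1, f2, f3}" and ?I' = "ideal_gen {g1, g2, g3}"
  have h: "int (hilb ?I e) = ci_hilb d1 d2 d3 e" "int (hilb ?I' e) = ci_hilb d1 d2 d3 e" for e
    using hilb_complete_intersection assms by blast+
  have eq: "hilb ?I' = hilb ?I"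
  proof
    fix e show "hilb ?I' e = hilb ?I e" using h(1)[of e] h(2)[of e] by linarith
  qed
  have D: "hilb ?I e = 0" "hilb ?I' e = 0" if "d1 + d2 + d3 \<le> e" for e
    using h[of e] ci_hilb_eq_0[OF that] by simp_all
  have one: "1 \<notin> ?I" "1 \<notin> ?I'" using assms(4,9) by (simp_all add: regular_seq3_def)
  let ?J = "ideal_gen {monom a | a. a \<notin> stdset (hilb ?I)} :: 'a poly3 set"
  note gin = gin_of_lefschetz_ideal[OF graded_ideal3[OF assms(5-7)] one(1) assms(8) D(1)]
  have "is_gin ?I ?J" by (rule gin(1))
  moreover have "almost_revlex ?J" by (rule gin(2))
  \<comment> \<open>The ideal is written in terms of the Hilbert function alone, so replacing one
    Hilbert function by the other leaves the same set.\<close>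
  moreover have "is_gin ?I' ?J"
    unfolding eq[symmetric]
    by (rule gin_of_lefschetz_ideal(1)[OF graded_ideal3[OF assms(10-12)] one(2) assms(13) D(2)])
  ultimately show ?thesis by blast
qed

end
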